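(* Let $d\geqslant1$ and let $U:\mathbb Z^d\to\mathbb R$ satisfy $\sum_{x\in\mathbb Z^d}e^{-U(x)}<+\infty$. Let $Q$ be the transition operator of the Zig-Zag walk on $\mathbb Z^d$ associated to $U$. Suppose that $U$ admits a strict local minimum at some $x_*\in\mathbb Z^d$ and that there exist $R,h>0$ such that for all $i\in\{1,\dots,d\}$, $x\in\mathbb Z^d$ and $v\in\{-1,1\}^d$, $$(U(x+v_ie_i)-U(x))_+\ \geqslant\ h\,\mathbf 1_{\{v_ix_i>R\}}.$$ Set $\mathcal W(x,v)=\sum_{i=1}^de^{h|x_i|/2}$. Then there exist $C>0$ and $\rho\in(0,1)$ such that for all $x\in\mathbb Z^d$, $v\in\{-1,1\}^d$ and $n\geqslant1$, $$\|\delta_{(x,v)}Q^{2n}-\mu_{\sigma(x,v)}\|_{\mathcal W}\ \leqslant\ C\rho^n\,\mathcal W(x,v).$$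
   Context: Let $(r)_+=\max(r,0)$, let $e_i$ be the $i$-th vector of the canonical basis of $\mathbb R^d$, and $\pi(x)=e^{-U(x)}/\sum_{y\in\mathbb Z^d}e^{-U(y)}$. For $x\in\mathbb Z^d$, $v,w\in\{-1,1\}^d$, set $$q_i(x,v_i)=e^{-(U(x+v_ie_i)-U(x))_+},\qquad p_i(x,v_i;w_i)=q_i(x,v_i)\mathbf 1_{w_i=v_i}+(1-q_i(x,v_i))\mathbf 1_{w_i=-v_i},$$ $$p(x,v;w)=\prod_{i=1}^d p_i\Big(x+\sum_{j=1}^{i-1}\frac{v_j+w_j}2e_j,\ v_i;\ w_i\Big).$$ The Zig-Zag walk on $\mathbb Z^d$ associated to $U$ is the Markov chain on $\mathbb Z^d\times\{-1,1\}^d$ with transitions $V_{n+1}\sim p(X_n,V_n;\cdot)$, $X_{n+1}=X_n+\frac12(V_n+V_{n+1})$; its transition operator is $Qf(x,v)=\sum_{w\in\{-1,1\}^d}f\big(x+\frac{v+w}2,w\big)p(x,v;w)$. The signature of $(x,v)$ is $\sigma(x,v)=((-1)^{x_i}v_i)_{1\leqslant i\leqslant d}\in\{-1,1\}^d$. For $s\in\{-1,1\}^d$, let $v(x,s)$ be the unique vector of $\{-1,1\}^d$ with $\sigma(x,v(x,s))=s$, and let $\mu_s$ be the probability measure on $\mathbb Z^d\times\{-1,1\}^d$ given by $\mu_s(x,v)=\pi(x)\mathbf 1_{v=v(x,s)}$. For probability measures $\nu_1,\nu_2$ on $\mathbb Z^d\times\{-1,1\}^d$ integrating $\mathcal W$,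 $\|\nu_1-\nu_2\|_{\mathcal W}=\sup_{|f|\leqslant\mathcal W}(\nu_1(f)-\nu_2(f))$. A strict local minimum of $U$ at $x_*$ means $U(x_*\pm e_i)>U(x_* )$ for all $i\in\{1,\dots,d\}$. *)

theory Defs
  imports "HOL-Probability.Probability"
begin

text \<open>The coordinates are indexed by a finite linearly ordered type \<open>'d\<close>, i.e. by
  \<open>{1, \<dots>, d}\<close> with \<open>d = CARD('d) \<ge> 1\<close>; the order matters because the coordinates of the walk
  are updated one after the other.\<close>

type_synonym 'd state = "(int ^ 'd) \<times> (int ^ 'd)"

definition signs :: "(int ^ 'd::finite) set" where
  "signs = {v. \<forall>i. v $ i \<in> {-1, 1}}"

definition states :: "'d::finite state set" where
  "states = UNIV \<times> signs"

definition gibbs :: "(int ^ 'd::finite \<Rightarrow> real) \<Rightarrow> int ^ 'd \<Rightarrow> real" where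
  "gibbs U x = exp (- U x) / (\<Sum>\<^sub>\<infinity>y. exp (- U y))"

definition accept :: "(int ^ 'd::finite \<Rightarrow> real) \<Rightarrow> 'd \<Rightarrow> int ^ 'd \<Rightarrow> int \<Rightarrow> real" where
  "accept U i x a = exp (- max (U (x + a *s axis i 1) - U x) 0)"

definition coord_prob :: "(int ^ 'd::finite \<Rightarrow> real) \<Rightarrow> 'd \<Rightarrow> int ^ 'd \<Rightarrow> int \<Rightarrow> int \<Rightarrow> real" where
  "coord_prob U i x a b =
     accept U i x a * of_bool (b = a) + (1 - accept U i x a) * of_bool (b = - a)"

text \<open>For \<open>v, w \<in> signs\<close> every \<open>v $ j + w $ j\<close> is even, so the integer divisions by 2 below are exact.\<close>

definition zz_prob ::
    "(int ^ 'd::{finite,linorder} \<Rightarrow> real) \<Rightarrow> int ^ 'd::{finite,linorder}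
      \<Rightarrow> int ^ 'd::{finite,linorder} \<Rightarrow> int ^ 'd::{finite,linorder} \<Rightarrow> real" where
  "zz_prob U x v w =
     (\<Prod>i\<in>UNIV. coord_prob U i
        (x + (\<Sum>j | j < i. ((v $ j + w $ j) div 2) *s axis j 1)) (v $ i) (w $ i))"

definition zz_op ::
    "(int ^ 'd::{finite,linorder} \<Rightarrow> real) \<Rightarrow> ('d::{finite,linorder} state \<Rightarrow> real)
      \<Rightarrow> 'd::{finite,linorder} state \<Rightarrow> real" where
  "zz_op U f = (\<lambda>(x, v). \<Sum>w\<in>signs. f (x + (\<chi> j. (v $ j + w $ j) div 2), w) * zz_prob U x v w)"

text \<open>The measure \<open>\<nu>P\<close> on the countable state space, for a Markov operator \<open>P\<close> acting on functions:
  it gives mass \<open>\<nu>(P 1\<^bsub>{z}\<^esub>)\<close> to the state \<open>z\<close>.\<close>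

definition meas_op ::
    "'d::finite state measure \<Rightarrow> (('d state \<Rightarrow> real) \<Rightarrow> 'd state \<Rightarrow> real) \<Rightarrow> 'd state measure" where
  "meas_op \<nu> P = point_measure states (\<lambda>z. ennreal (\<integral>y. P (indicator {z}) y \<partial>\<nu>))"

definition dirac :: "'d::finite state \<Rightarrow> 'd state measure" where
  "dirac z = return (count_space states) z"

definition signature :: "'d::finite state \<Rightarrow> int ^ 'd" where
  "signature = (\<lambda>(x, v). \<chi> i. (if even (x $ i) then 1 else - 1) * v $ i)"

definition velocity :: "int ^ 'd::finite \<Rightarrow> int ^ 'd \<Rightarrow> int ^ 'd" where
  "velocity x s = (THE v. v \<in> signs \<and> signature (x, v) = s)"

definition sig_measure :: "(int ^ 'd::finite \<Rightarrow> real) \<Rightarrow> int ^ 'd \<Rightarrow> 'd state measure" where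
  "sig_measure U s =
     point_measure states (\<lambda>(x, v). ennreal (gibbs U x * of_bool (v = velocity x s)))"

text \<open>The weighted distance is only meant for measures integrating \<open>W\<close>. It is set to \<open>\<infinity>\<close> otherwise,
  so that a finite bound includes the integrability of \<open>W\<close>; without this the convention that
  non-integrable functions have integral 0 would give meaningless values.\<close>

definition weighted_dist ::
    "('d::finite state \<Rightarrow> real) \<Rightarrow> 'd state measure \<Rightarrow> 'd state measure \<Rightarrow> ereal" where
  "weighted_dist W \<nu>1 \<nu>2 =
     (if integrable \<nu>1 W \<and> integrable \<nu>2 W
      then (SUP f \<in> {f. \<forall>z\<in>states. \<bar>f z\<bar> \<le> W z}. ereal ((\<integral>z. f z \<partial>\<nu>1) - (\<integral>z. f z \<partial>\<nu>2)))
      else \<infinity>)"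

definition strict_local_min :: "(int ^ 'd::finite \<Rightarrow> real) \<Rightarrow> int ^ 'd \<Rightarrow> bool" where
  "strict_local_min U x \<longleftrightarrow> (\<forall>i. U (x + axis i 1) > U x \<and> U (x - axis i 1) > U x)"

definition lyapunov :: "real \<Rightarrow> 'd::finite state \<Rightarrow> real" where
  "lyapunov h = (\<lambda>(x, v). \<Sum>i\<in>UNIV. exp (h * \<bar>real_of_int (x $ i)\<bar> / 2))"

end

theory Submission
  imports Defs
begin

text \<open>Every coordinate update flips one entry of the signature. For a fixed signature, coordinate \<open>i\<close>
  is matched with a neighbour, and the update is the Metropolis rule on the pair; hence it
  preserves \<open>\<pi>\<close>, and two steps of the walk form a Markov kernel on the signature class that
  preserves \<open>\<mu>\<^sub>s\<close>. Giving outward velocities a larger weight turns the growth of \<open>U\<close> into a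
  geometric drift condition. Beyond \<open>R\<close> a coordinate that moves outwards may turn or continue,
  whatever the other coordinates do, so all coordinates can be brought to \<open>0\<close> at the same large
  even time, with the velocity prescribed by the signature. This gives a minorization on sublevel
  sets, and the theorem follows from the Hairer-Mattingly form of Harris' theorem.\<close>

section \<open>Finitely supported Markov operators\<close>

text \<open>One step of the walk sends a class to the opposite one, so the law alternates between
  two disjoint sets: only even times can converge, with a limit that depends on the class. The
  contraction is proved for functions. Kernels are finite averages, so no integrability question
  arises before the Gibbs measure enters, and the weighted distance comes from integrating an
  oscillation estimate. The exponent h/2 balances two demands: a unit step outwards beyond R
  multiplies the weight by exp(h/2) but is accepted with probability at most exp(-h), and exp(-U)
  loses a factor exp(-h) per unit, which leaves the weight integrable. The sweep is sequential, so
  acceptance in one coordinate sees the new values of the earlier ones; as the growth hypothesis is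
  uniform in the other coordinates, drift and reachability can still be checked one coordinate at a
  time.\<close>

definition markov_on :: "'a set \<Rightarrow> 'b set \<Rightarrow> (('b \<Rightarrow> real) \<Rightarrow> 'a \<Rightarrow> real) \<Rightarrow> bool" where
  "markov_on S S' T \<longleftrightarrow> (\<forall>z\<in>S. \<exists>p. finite (set_pmf p) \<and> set_pmf p \<subseteq> S' \<and>
     (\<forall>f. T f z = measure_pmf.expectation p f))"

lemma markov_onE:
  assumes "markov_on S S' T" "z \<in> S"
  obtains p where "finite (set_pmf p)" "set_pmf p \<subseteq> S'"
    "\<And>f. T f z = measure_pmf.expectation p f"
  using assms unfolding markov_on_def by blast

lemma markov_on_id: "markov_on S S id"
  unfolding markov_on_def by (auto intro!: exI[of _ "return_pmf _"])

lemma markov_on_comp: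
  assumes "markov_on S S' T" "markov_on S' S'' T'"
  shows "markov_on S S'' (T \<circ> T')"
  unfolding markov_on_def
proof
  fix z assume "z \<in> S"
  then obtain p where p: "finite (set_pmf p)" "set_pmf p \<subseteq> S'"
    "\<And>f. T f z = measure_pmf.expectation p f"
    using markov_onE assms(1) by metis
  have "\<forall>y\<in>S'. \<exists>q. finite (set_pmf q) \<and> set_pmf q \<subseteq> S'' \<and>
     (\<forall>f. T' f y = measure_pmf.expectation q f)"
    using assms(2) by (simp add: markov_on_def)
  then obtain q where q: "\<And>y. y \<in> S' \<Longrightarrow> finite (set_pmf (q y))"
      "\<And>y. y \<in> S' \<Longrightarrow> set_pmf (q y) \<subseteq> S''"
      "\<And>y f. y \<in> S' \<Longrightarrow> T' f y = measure_pmf.expectation (q y) f"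
    by metis
  have "(T \<circ> T') f z = measure_pmf.expectation (p \<bind> q) f" for f
  proof -
    have "measure_pmf.expectation (p \<bind> q) f
        = (\<Sum>a\<in>set_pmf p. pmf p a *\<^sub>R measure_pmf.expectation (q a) f)"
      using p q by (intro pmf_expectation_bind) auto
    also have "\<dots> = (\<Sum>a\<in>set_pmf p. pmf p a *\<^sub>R T' f a)"
      using p q by (intro sum.cong) auto
    also have "\<dots> = T (T' f) z"
      unfolding p(3) using p(1) by (subst integral_measure_pmf[where A="set_pmf p"]) auto
    finally show ?thesis by simp
  qed
  moreover have "finite (set_pmf (p \<bind> q))" "set_pmf (p \<bind> q) \<subseteq> S''"
    using p q by (auto dest!: subsetD)
  ultimately show "\<exists>p. finite (set_pmf p) \<and> set_pmf p \<subseteq> S'' \<and>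
     (\<forall>f. (T \<circ> T') f z = measure_pmf.expectation p f)" by blast
qed

lemma markov_on_power: "markov_on S S T \<Longrightarrow> markov_on S S (T ^^ n)"
  by (induction n) (auto simp: markov_on_id[unfolded id_def] markov_on_id intro: markov_on_comp)

lemma markov_on_const:
  assumes "markov_on S S' T" "z \<in> S"
  shows "T (\<lambda>_. c) z = c"
  using assms by (elim markov_onE[where z=z]) auto

lemma markov_on_affine:
  assumes "markov_on S S' T" "z \<in> S"
  shows "T (\<lambda>y. a * f y + c) z = a * T f z + c"
  using assms by (elim markov_onE[where z=z]) (auto simp: integrable_measure_pmf_finite)

lemma markov_on_diff:
  assumes "markov_on S S' T" "z \<in> S"
  shows "T (\<lambda>y. f y - g y) z = T f z - T g z"
  using assms by (elim markov_onE[where z=z]) (auto simp: integrable_measure_pmf_finite)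

lemma markov_on_sum:
  assumes "markov_on S S' T" "z \<in> S"
  shows "T (\<lambda>y. \<Sum>i\<in>I. f i y) z = (\<Sum>i\<in>I. T (f i) z)"
  using assms by (elim markov_onE[where z=z]) (auto simp: integrable_measure_pmf_finite)

lemma markov_on_mono:
  assumes "markov_on S S' T" "z \<in> S" "\<And>y. y \<in> S' \<Longrightarrow> f y \<le> g y"
  shows "T f z \<le> T g z"
  using assms(1,2)
proof (elim markov_onE[where z=z])
  fix p assume p: "finite (set_pmf p)" "set_pmf p \<subseteq> S'" "\<And>f. T f z = measure_pmf.expectation p f"
  show ?thesis unfolding p(3)
    using p assms(3) by (intro integral_mono_AE)
      (auto simp: integrable_measure_pmf_finite AE_measure_pmf_iff)
qed

lemma markov_on_abs_le:
  assumes T: "markov_on S S' T" "z \<in> S" and f: "\<And>y. y \<in> S' \<Longrightarrow> \<bar>f y\<bar> \<le> g y"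
  shows "\<bar>T f z\<bar> \<le> T g z"
proof -
  have "T f z \<le> T g z" using f by (intro markov_on_mono[OF T]) fastforce
  moreover have "T (\<lambda>y. - 1 * f y + 0) z \<le> T g z" using f by (intro markov_on_mono[OF T]) fastforce
  ultimately show ?thesis unfolding markov_on_affine[OF T] by simp
qed

section \<open>Harris' theorem\<close>

text \<open>The intervals [f x - b x, f x + b x] meet pairwise, so on the real line they share a
  point, namely the supremum of the left ends. This turns an oscillation bound into a pointwise
  bound on a centred function.\<close>

lemma oscillation_to_sup_bound:
  fixes f b :: "'a \<Rightarrow> real"
  assumes "\<And>x y. x \<in> S \<Longrightarrow> y \<in> S \<Longrightarrow> \<bar>f x - f y\<bar> \<le> b x + b y"
  obtains c where "\<And>x. x \<in> S \<Longrightarrow> \<bar>f x - c\<bar> \<le> b x"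
proof (cases "S = {}")
  case False
  then obtain x0 where x0: "x0 \<in> S" by blast
  let ?A = "(\<lambda>x. f x - b x) ` S"
  have le: "f x - b x \<le> f y + b y" if "x \<in> S" "y \<in> S" for x y
    using assms[OF that] by linarith
  have bdd: "bdd_above ?A" using le[OF _ x0] by (auto intro!: bdd_aboveI)
  have "\<bar>f x - Sup ?A\<bar> \<le> b x" if "x \<in> S" for x
  proof -
    have "f x - b x \<le> Sup ?A" using that bdd by (intro cSup_upper) auto
    moreover have "Sup ?A \<le> f x + b x" using that le False by (intro cSup_least) auto
    ultimately show ?thesis by linarith
  qed
  then show thesis by (rule that)
qed (use that in auto)

text \<open>If V x + V y is at least R0, the drift shrinks the weighted part of the bound; otherwise
  both points lie in the sublevel set and the minorization removes mass \<epsilon> from each kernel.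
  The scalar inequalities \<open>far\<close> and \<open>near\<close> say that either gain yields the
  factor \<alpha>.\<close>

lemma harris_contraction:
  fixes V f :: "'a \<Rightarrow> real"
  assumes T: "markov_on S S T" and V: "\<And>z. z \<in> S \<Longrightarrow> V z \<ge> 0"
    and drift: "\<And>z. z \<in> S \<Longrightarrow> T V z \<le> \<gamma> * V z + C"
    and z0: "z0 \<in> S" and eps: "\<epsilon> \<ge> 0"
    and minor: "\<And>z g. z \<in> S \<Longrightarrow> V z \<le> R0 \<Longrightarrow> (\<And>y. y \<in> S \<Longrightarrow> g y \<ge> 0) \<Longrightarrow> T g z \<ge> \<epsilon> * g z0"
    and \<beta>: "\<beta> > 0"
    and far: "\<And>D. D \<ge> R0 \<Longrightarrow> 2 + \<gamma> * \<beta> * D + 2 * \<beta> * C \<le> \<alpha> * (2 + \<beta> * D)"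
    and near: "\<And>D. D \<ge> 0 \<Longrightarrow> 2 - 2 * \<epsilon> + \<gamma> * \<beta> * D + 2 * \<beta> * C \<le> \<alpha> * (2 + \<beta> * D)"
    and L: "L \<ge> 0"
    and f: "\<And>x y. x \<in> S \<Longrightarrow> y \<in> S \<Longrightarrow> \<bar>f x - f y\<bar> \<le> L * (2 + \<beta> * (V x + V y))"
    and x: "x \<in> S" and y: "y \<in> S"
  shows "\<bar>T f x - T f y\<bar> \<le> \<alpha> * L * (2 + \<beta> * (V x + V y))"
proof -
  obtain c where c: "\<And>x. x \<in> S \<Longrightarrow> \<bar>f x - c\<bar> \<le> L * (1 + \<beta> * V x)"
    using oscillation_to_sup_bound[of S f "\<lambda>x. L * (1 + \<beta> * V x)"] f
    by (force simp: algebra_simps)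
  define g where "g = (\<lambda>z. f z - c)"
  define b where "b = (\<lambda>z. L * \<beta> * V z + L)"
  have g: "\<bar>g z\<bar> \<le> b z" if "z \<in> S" for z
    using c[OF that] by (simp add: g_def b_def algebra_simps)
  have Tg: "T g z = T f z - c" if "z \<in> S" for z
    using markov_on_affine[OF T that, of 1 f "-c"] by (simp add: g_def)
  have Tb: "T b z \<le> L * (1 + \<beta> * (\<gamma> * V z + C))" if "z \<in> S" for z
  proof -
    have "T b z = L * \<beta> * T V z + L" unfolding b_def by (rule markov_on_affine[OF T that])
    also have "L * \<beta> * T V z \<le> L * \<beta> * (\<gamma> * V z + C)"
      using L \<beta> drift[OF that] by (intro mult_left_mono) auto
    finally show ?thesis by (simp add: algebra_simps)
  qed
  define D where "D = V x + V y"
  have D: "D \<ge> 0" using V[OF x] V[OF y] by (simp add: D_def)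
  have "\<bar>T g x - T g y\<bar> \<le> L * (\<alpha> * (2 + \<beta> * D))"
  proof (cases "D \<ge> R0")
    case True
    have "\<bar>T g x - T g y\<bar> \<le> T b x + T b y"
      using markov_on_abs_le[where f = g, OF T x g] markov_on_abs_le[where f = g, OF T y g] by linarith
    also have "\<dots> \<le> L * (2 + \<gamma> * \<beta> * D + 2 * \<beta> * C)"
      using Tb[OF x] Tb[OF y] by (simp add: D_def algebra_simps)
    also have "\<dots> \<le> L * (\<alpha> * (2 + \<beta> * D))"
      using far[OF True] L by (intro mult_left_mono) auto
    finally show ?thesis .
  next
    case False
    have small: "V x \<le> R0" "V y \<le> R0" using V[OF x] V[OF y] False by (auto simp: D_def)
    \<comment> \<open>As V is nonnegative, the mass removed at z0 carries at least the constant part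
      L of the envelope.\<close>
    have b0: "L \<le> b z0" using L \<beta> V[OF z0] by (simp add: b_def)
    text \<open>Subtracting \<open>\<epsilon> g(z0)\<close> at both points does not change the difference and leaves positive
      functionals of mass \<open>1 - \<epsilon>\<close>.\<close>
    have res: "\<bar>T g z - \<epsilon> * g z0\<bar> \<le> T b z - \<epsilon> * b z0" if "z \<in> S" "V z \<le> R0" for z
    proof -
      have *: "\<epsilon> * (b z0 - g z0) \<le> T (\<lambda>y. b y - g y) z"
        using g by (intro minor that) (force simp: abs_le_iff)
      have "\<epsilon> * (b z0 - (- 1 * g z0 + 0)) \<le> T (\<lambda>y. b y - (- 1 * g y + 0)) z"
        using g by (intro minor[OF that, where g = "\<lambda>y. b y - (- 1 * g y + 0)"]) (force simp: abs_le_iff)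
      then show ?thesis
        using * unfolding markov_on_diff[OF T that(1)] markov_on_affine[OF T that(1)]
        by (simp add: algebra_simps abs_le_iff)
    qed
    have "\<bar>T g x - T g y\<bar> \<le> T b x + T b y - 2 * \<epsilon> * b z0"
      using res[OF x small(1)] res[OF y small(2)] by linarith
    also have "\<dots> \<le> T b x + T b y - 2 * \<epsilon> * L"
      using b0 eps by (simp add: mult_left_mono)
    also have "\<dots> \<le> L * (2 - 2 * \<epsilon> + \<gamma> * \<beta> * D + 2 * \<beta> * C)"
      using Tb[OF x] Tb[OF y] by (simp add: D_def algebra_simps)
    also have "\<dots> \<le> L * (\<alpha> * (2 + \<beta> * D))"
      using near[OF D] L by (intro mult_left_mono) auto
    finally show ?thesis .
  qed
  then show ?thesis using Tg x y by (simp add: D_def algebra_simps)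
qed

text \<open>\<beta> is so small that 2 * \<beta> * C consumes at most half of the minorization gain
  2 * \<epsilon>; beyond R0 it consumes at most half of the drift gain (1 - \<gamma>) * \<beta> *
  D.\<close>

lemma harris_constants:
  fixes \<gamma> C \<epsilon> R0 :: real
  assumes "0 \<le> \<gamma>" "\<gamma> < 1" "0 \<le> C" "0 < \<epsilon>" "R0 = 4 * (C + 1) / (1 - \<gamma>)"
  obtains \<alpha> \<beta> :: real where "0 < \<beta>" "0 < \<alpha>" "\<alpha> < 1"
    "\<And>D. D \<ge> R0 \<Longrightarrow> 2 + \<gamma> * \<beta> * D + 2 * \<beta> * C \<le> \<alpha> * (2 + \<beta> * D)"
    "\<And>D. D \<ge> 0 \<Longrightarrow> 2 - 2 * \<epsilon> + \<gamma> * \<beta> * D + 2 * \<beta> * C \<le> \<alpha> * (2 + \<beta> * D)"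
proof -
  define \<beta> where "\<beta> = \<epsilon> / (2 * (C + 1))"
  \<comment> \<open>In the far case the other half of the drift gain is split between \<delta> *
    \<beta> * D and 2 * \<delta>, which gives the last two bounds. The bound \<epsilon> / 2 serves
    the near case, and 1 / 2 keeps 1 - \<delta> positive.\<close>
  define \<delta> where "\<delta> = min (min (1 / 2) (\<epsilon> / 2)) (min ((1 - \<gamma>) / 4) ((1 - \<gamma>) * \<beta> * R0 / 8))"
  have R0: "R0 > 0" using assms by simp
  have \<beta>: "\<beta> > 0" using assms by (simp add: \<beta>_def)
  have \<beta>C: "2 * \<beta> * C \<le> \<epsilon>" using assms by (simp add: \<beta>_def field_simps)
  have "(1 - \<gamma>) * \<beta> * R0 > 0" using assms \<beta> R0 by simp
  then have \<delta>: "\<delta> > 0" "\<delta> \<le> 1 / 2" "\<delta> \<le> \<epsilon> / 2" "\<delta> \<le> (1 - \<gamma>) / 4"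
      "\<delta> \<le> (1 - \<gamma>) * \<beta> * R0 / 8"
    using assms(2,4) unfolding \<delta>_def by (simp_all only: min_le_iff_disj) auto
  show thesis
  proof (rule that[of \<beta> "1 - \<delta>"])
    fix D assume D: "D \<ge> R0"
    have "2 * C \<le> (1 - \<gamma>) / 2 * R0" using assms(1-3) unfolding assms(5) by (simp add: field_simps)
    also have "\<dots> \<le> (1 - \<gamma>) / 2 * D" using D assms by (intro mult_left_mono) auto
    finally have "\<beta> * (2 * C) \<le> \<beta> * ((1 - \<gamma>) / 2 * D)" using \<beta> by (intro mult_left_mono) auto
    moreover have "\<delta> * (\<beta> * D) \<le> (1 - \<gamma>) / 4 * (\<beta> * D)"
      using \<delta> D R0 \<beta> by (intro mult_right_mono) auto
    moreover have "(1 - \<gamma>) * \<beta> * R0 \<le> (1 - \<gamma>) * \<beta> * D"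
      using D assms \<beta> by (intro mult_left_mono) auto
    ultimately show "2 + \<gamma> * \<beta> * D + 2 * \<beta> * C \<le> (1 - \<delta>) * (2 + \<beta> * D)"
      using \<delta>(5) by (simp add: algebra_simps)
  next
    fix D :: real assume D: "D \<ge> 0"
    have "\<delta> * (\<beta> * D) \<le> (1 - \<gamma>) * (\<beta> * D)"
      using \<delta> D \<beta> assms by (intro mult_right_mono) auto
    then show "2 - 2 * \<epsilon> + \<gamma> * \<beta> * D + 2 * \<beta> * C \<le> (1 - \<delta>) * (2 + \<beta> * D)"
      using \<beta>C \<delta>(3) by (simp add: algebra_simps)
  qed (use \<beta> \<delta> in auto)
qed

text \<open>C / (1 - \<gamma>) is the fixed point of the map sending t to \<gamma> * t + C, so one
  additive constant serves all powers, including the long ones for which a minorization is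
  available.\<close>

lemma drift_power:
  assumes T: "markov_on S S T" and \<gamma>: "0 \<le> \<gamma>" "\<gamma> < 1" and C: "0 \<le> C"
    and drift: "\<And>z. z \<in> S \<Longrightarrow> T V z \<le> \<gamma> * V z + C" and z: "z \<in> S"
  shows "(T ^^ n) V z \<le> \<gamma> ^ n * V z + C / (1 - \<gamma>)"
proof (induction n)
  case (Suc n)
  have Tn: "markov_on S S (T ^^ n)" using T by (rule markov_on_power)
  have "(T ^^ Suc n) V z = (T ^^ n) (T V) z" by (simp add: funpow_swap1)
  also have "\<dots> \<le> (T ^^ n) (\<lambda>z. \<gamma> * V z + C) z" using drift by (intro markov_on_mono[OF Tn z])
  also have "\<dots> = \<gamma> * (T ^^ n) V z + C" by (rule markov_on_affine[OF Tn z])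
  also have "\<dots> \<le> \<gamma> * (\<gamma> ^ n * V z + C / (1 - \<gamma>)) + C"
    using Suc \<gamma> by (intro add_right_mono mult_left_mono) auto
  also have "\<dots> = \<gamma> ^ Suc n * V z + C / (1 - \<gamma>)" using \<gamma> by (simp add: field_simps)
  finally show ?case .
qed (use \<gamma> C in auto)

lemma harris_power:
  fixes V f :: "'a \<Rightarrow> real"
  assumes T: "markov_on S S T" and V: "\<And>z. z \<in> S \<Longrightarrow> V z \<ge> 0"
    and drift: "\<And>z. z \<in> S \<Longrightarrow> T V z \<le> \<gamma> * V z + C"
    and z0: "z0 \<in> S" and eps: "\<epsilon> \<ge> 0"
    and minor: "\<And>z g. z \<in> S \<Longrightarrow> V z \<le> R0 \<Longrightarrow> (\<And>y. y \<in> S \<Longrightarrow> g y \<ge> 0) \<Longrightarrow> T g z \<ge> \<epsilon> * g z0"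
    and \<beta>: "\<beta> > 0" and \<alpha>: "\<alpha> > 0"
    and far: "\<And>D. D \<ge> R0 \<Longrightarrow> 2 + \<gamma> * \<beta> * D + 2 * \<beta> * C \<le> \<alpha> * (2 + \<beta> * D)"
    and near: "\<And>D. D \<ge> 0 \<Longrightarrow> 2 - 2 * \<epsilon> + \<gamma> * \<beta> * D + 2 * \<beta> * C \<le> \<alpha> * (2 + \<beta> * D)"
    and L: "L \<ge> 0"
    and f: "\<And>x y. x \<in> S \<Longrightarrow> y \<in> S \<Longrightarrow> \<bar>f x - f y\<bar> \<le> L * (2 + \<beta> * (V x + V y))"
  shows "x \<in> S \<Longrightarrow> y \<in> S \<Longrightarrow> \<bar>(T ^^ m) f x - (T ^^ m) f y\<bar> \<le> \<alpha> ^ m * L * (2 + \<beta> * (V x + V y))"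
proof (induction m arbitrary: x y)
  case (Suc m)
  have "\<bar>T ((T ^^ m) f) x - T ((T ^^ m) f) y\<bar> \<le> \<alpha> * (\<alpha> ^ m * L) * (2 + \<beta> * (V x + V y))"
    using L \<alpha> Suc
    by (intro harris_contraction[OF T V drift z0 eps minor \<beta> far near]) auto
  then show ?case by (simp add: algebra_simps)
qed (use f in auto)

section \<open>Coordinate updates\<close>

definition flip :: "'d set \<Rightarrow> int ^ 'd \<Rightarrow> int ^ 'd::finite" where
  "flip A v = (\<chi> i. if i \<in> A then - v $ i else v $ i)"

definition move :: "'d set \<Rightarrow> int ^ 'd \<Rightarrow> int ^ 'd \<Rightarrow> int ^ 'd::finite" where
  "move M x v = (\<chi> i. if i \<in> M then x $ i + v $ i else x $ i)"

lemma flip_nth [simp]: "flip A v $ i = (if i \<in> A then - v $ i else v $ i)"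
  by (simp add: flip_def)

lemma move_nth [simp]: "move M x v $ i = (if i \<in> M then x $ i + v $ i else x $ i)"
  by (simp add: move_def)

lemma move_singleton: "move {i} x v = x + v $ i *s axis i 1"
  by (auto simp: vec_eq_iff axis_def)

lemma flip_empty [simp]: "flip {} v = v" and move_empty [simp]: "move {} x v = x"
  by (auto simp: vec_eq_iff)

lemma flip_flip: "flip A (flip B v) = flip ((A - B) \<union> (B - A)) v"
  by (auto simp: vec_eq_iff)

lemma mem_signs: "v \<in> signs \<longleftrightarrow> (\<forall>i. v $ i = 1 \<or> v $ i = - 1)"
  by (auto simp: signs_def)

lemma mem_states [simp]: "(x, v) \<in> states \<longleftrightarrow> v \<in> signs"
  by (simp add: states_def)

lemma flip_signs [simp]: "flip A v \<in> signs \<longleftrightarrow> v \<in> signs"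
proof -
  have "flip A v $ i = 1 \<or> flip A v $ i = - 1 \<longleftrightarrow> v $ i = 1 \<or> v $ i = - 1" for i
    by auto
  then show ?thesis unfolding mem_signs by simp
qed

lemma finite_vec_bounded: "finite {x :: int ^ 'd::finite. \<forall>i. \<bar>x $ i\<bar> \<le> b}"
proof -
  have "finite (vec_nth ` {x :: int ^ 'd. \<forall>i. \<bar>x $ i\<bar> \<le> b})"
    by (rule finite_subset[OF _ finite_PiE[of UNIV "\<lambda>_. {-b..b}"]]) (auto simp: PiE_def abs_le_iff minus_le_iff)
  then show ?thesis by (rule finite_imageD) (auto simp: inj_on_def vec_nth_inject)
qed

lemma finite_signs: "finite (signs :: (int ^ 'd::finite) set)"
  by (rule finite_subset[OF _ finite_vec_bounded[of 1]]) (auto simp: mem_signs, metis abs_1 abs_minus_cancel order_refl)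

lemma accept_pos [simp]: "0 < accept U i x a" and accept_nonneg [simp]: "0 \<le> accept U i x a"
  and accept_le_1 [simp]: "accept U i x a \<le> 1"
  by (auto simp: accept_def)

definition coord_op :: "(int ^ 'd::finite \<Rightarrow> real) \<Rightarrow> 'd \<Rightarrow> ('d state \<Rightarrow> real) \<Rightarrow> 'd state \<Rightarrow> real" where
  "coord_op U i f = (\<lambda>(x, v). accept U i x (v $ i) * f (move {i} x v, v)
     + (1 - accept U i x (v $ i)) * f (x, flip {i} v))"

definition sweep_prob :: "(int ^ 'd::{finite,linorder} \<Rightarrow> real) \<Rightarrow> 'd set \<Rightarrow> int ^ 'd::{finite,linorder}
    \<Rightarrow> int ^ 'd::{finite,linorder} \<Rightarrow> 'd set \<Rightarrow> real" where
  "sweep_prob U A x v M = (\<Prod>i\<in>A. let q = accept U i (move (M \<inter> {..<i}) x v) (v $ i)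
     in if i \<in> M then q else 1 - q)"

text \<open>The walk in which only the coordinates in \<open>A\<close> are updated; \<open>M\<close> is the set of coordinates that
  move, the ones in \<open>A - M\<close> reverse their velocity.\<close>

definition sweep :: "(int ^ 'd::{finite,linorder} \<Rightarrow> real) \<Rightarrow> 'd set
    \<Rightarrow> ('d::{finite,linorder} state \<Rightarrow> real) \<Rightarrow> 'd state \<Rightarrow> real" where
  "sweep U A f = (\<lambda>(x, v). \<Sum>M\<in>Pow A. sweep_prob U A x v M * f (move M x v, flip (A - M) v))"

lemma sweep_empty: "sweep U {} = id"
  by (auto simp: sweep_def sweep_prob_def fun_eq_iff)

text \<open>Operators act on functions, so the last update is the rightmost factor. As b is the
  largest index, the factors of A do not see whether b moves, while b sees all of M; the sum over
  subsets splits accordingly.\<close>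

lemma sweep_insert:
  assumes b: "\<forall>a\<in>A. a < b"
  shows "sweep U (insert b A) = sweep U A \<circ> coord_op U b"
proof (intro ext, clarify)
  fix f x v
  have [simp]: "b \<notin> A" using b by auto
  let ?t = "\<lambda>M. sweep_prob U (insert b A) x v M * f (move M x v, flip (insert b A - M) v)"
  let ?q = "\<lambda>M. accept U b (move M x v) (v $ b)"
  have p1: "sweep_prob U (insert b A) x v M = sweep_prob U A x v M * (1 - ?q M)"
    if "M \<subseteq> A" for M
  proof -
    have "b \<notin> M" "M \<inter> {..<b} = M" using that b by auto
    then show ?thesis by (simp add: sweep_prob_def Let_def)
  qed
  have p2: "sweep_prob U (insert b A) x v (insert b M) = sweep_prob U A x v M * ?q M"
    if "M \<subseteq> A" for M
  proof -
    have "insert b M \<inter> {..<b} = M" using that b by auto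
    moreover have "(let q = accept U i (move (insert b M \<inter> {..<i}) x v) (v $ i)
        in if i \<in> insert b M then q else 1 - q) = (let q = accept U i (move (M \<inter> {..<i}) x v) (v $ i)
        in if i \<in> M then q else 1 - q)" if "i \<in> A" for i
    proof -
      have "insert b M \<inter> {..<i} = M \<inter> {..<i}" "i \<noteq> b" using that b by auto
      then show ?thesis by simp
    qed
    then have "(\<Prod>i\<in>A. let q = accept U i (move (insert b M \<inter> {..<i}) x v) (v $ i)
        in if i \<in> insert b M then q else 1 - q) = sweep_prob U A x v M"
      unfolding sweep_prob_def by (intro prod.cong) auto
    ultimately show ?thesis unfolding sweep_prob_def by (simp add: Let_def mult.commute)
  qed
  have d: "Pow A \<inter> insert b ` Pow A = {}" by auto
  have "sweep U (insert b A) f (x, v) = sum ?t (Pow A) + sum ?t (insert b ` Pow A)"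
    unfolding sweep_def Pow_insert split using d by (intro sum.union_disjoint) auto
  also have "sum ?t (insert b ` Pow A) = (\<Sum>M\<in>Pow A. ?t (insert b M))"
  proof (subst sum.reindex)
    show "inj_on (insert b) (Pow A)" unfolding inj_on_def using \<open>b \<notin> A\<close>
      by (metis PowD insert_ident subsetD)
  qed simp
  also have "sum ?t (Pow A) + (\<Sum>M\<in>Pow A. ?t (insert b M)) = (\<Sum>M\<in>Pow A. ?t M + ?t (insert b M))"
    by (simp add: sum.distrib)
  also have "\<dots> = sweep U A (coord_op U b f) (x, v)"
    unfolding sweep_def split
  proof (rule sum.cong)
    fix M assume "M \<in> Pow A"
    then have M: "M \<subseteq> A" by simp
    then have bM: "b \<notin> M" by auto
    have "flip (A - M) v $ b = v $ b" using bM by simp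
    moreover have "move {b} (move M x v) (flip (A - M) v) = move (insert b M) x v"
      using bM by (auto simp: vec_eq_iff)
    moreover have "flip {b} (flip (A - M) v) = flip (insert b A - M) v"
      using bM by (auto simp: vec_eq_iff)
    moreover have "insert b A - insert b M = A - M" by auto
    ultimately show "?t M + ?t (insert b M) =
        sweep_prob U A x v M * coord_op U b f (move M x v, flip (A - M) v)"
      unfolding p1[OF M] p2[OF M] coord_op_def split by (simp add: algebra_simps)
  qed simp
  finally show "sweep U (insert b A) f (x, v) = (sweep U A \<circ> coord_op U b) f (x, v)" by simp
qed

text \<open>A sign vector w is determined by the set M of coordinates where it agrees with v: these
  move, the others turn. On \<open>states\<close> the entries of v + w are even and those of v and
  -v differ, so the correspondence is a bijection.\<close>

lemma zz_op_eq_sweep: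
  assumes "z \<in> states"
  shows "zz_op U f z = sweep U UNIV f z"
proof -
  obtain x v where z: "z = (x, v)" "v \<in> signs" using assms by (cases z) auto
  have v: "v $ i = 1 \<or> v $ i = - 1" for i using z by (simp add: mem_signs)
  have v0: "v $ i \<noteq> 0" "v $ i \<noteq> - v $ i" for i using v[of i] by auto
  have ax: "(\<Sum>j | j < i. c j *s axis j 1) $ k = (if k < i then c k else 0)" for c :: "_ \<Rightarrow> int" and i k
    by (simp add: axis_def if_distrib[where f = "\<lambda>x. _ * x"] eq_commute[of k] cong: if_cong)
  have *: "f (x + (\<chi> j. (v $ j + w $ j) div 2), w) * zz_prob U x v w
      = sweep_prob U UNIV x v {i. w $ i = v $ i} *
          f (move {i. w $ i = v $ i} x v, flip (UNIV - {i. w $ i = v $ i}) v)"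
    if w: "w \<in> signs" for w
  proof -
    let ?M = "{i. w $ i = v $ i}"
    have wv: "w $ i = (if i \<in> ?M then v $ i else - v $ i)" for i
      using w v[of i] by (auto simp: mem_signs)
    then have wv': "w $ i \<noteq> v $ i \<Longrightarrow> w $ i = - v $ i" for i by (metis mem_Collect_eq)
    have d: "(v $ j + w $ j) div 2 = (if j \<in> ?M then v $ j else 0)" for j
      by (subst wv) auto
    have "x + (\<chi> j. (v $ j + w $ j) div 2) = move ?M x v" "w = flip (UNIV - ?M) v"
      using wv' by (auto simp: vec_eq_iff d)
    moreover have "x + (\<Sum>j | j < i. ((v $ j + w $ j) div 2) *s axis j 1) = move (?M \<inter> {..<i}) x v" for i
      unfolding vec_eq_iff vector_add_component ax d by auto
    moreover have "coord_prob U i y (v $ i) (w $ i) =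
        (if i \<in> ?M then accept U i y (v $ i) else 1 - accept U i y (v $ i))" for i y
      using wv[of i] v0[of i] by (auto simp: coord_prob_def)
    ultimately show ?thesis
      unfolding zz_prob_def sweep_prob_def Let_def by (simp add: mult.commute)
  qed
  have inv: "{i. flip (- M) v $ i = v $ i} = M" for M
    using v0 by auto
  show ?thesis
    unfolding z(1) zz_op_def sweep_def split
  proof (rule sum.reindex_bij_witness[where i = "\<lambda>M. flip (- M) v" and j = "\<lambda>w. {i. w $ i = v $ i}"])
    fix w :: "int ^ 'a::{finite,linorder}" assume "w \<in> signs"
    then show "flip (- {i. w $ i = v $ i}) v = w"
      using v by (auto simp: vec_eq_iff mem_signs) (metis add.inverse_inverse)
  qed (use z inv * in auto)
qed

section \<open>Signature classes\<close>

definition sig_class :: "int ^ 'd \<Rightarrow> 'd::finite state set" where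
  "sig_class s = {z \<in> states. signature z = s}"

lemma sig_class_subset: "sig_class s \<subseteq> states"
  by (auto simp: sig_class_def)

lemma signature_nth [simp]: "signature (x, v) $ i = (if even (x $ i) then v $ i else - v $ i)"
  by (simp add: signature_def)

lemma signature_signs [simp]: "signature (x, v) \<in> signs \<longleftrightarrow> v \<in> signs"
proof -
  have "signature (x, v) $ i = 1 \<or> signature (x, v) $ i = - 1 \<longleftrightarrow> v $ i = 1 \<or> v $ i = - 1" for i
    by auto
  then show ?thesis unfolding mem_signs by simp
qed

lemma signature_flip: "signature (x, flip A v) = flip A (signature (x, v))"
  by (auto simp: vec_eq_iff)

text \<open>A velocity entry is odd, so an accepted move changes the parity of x $ i. With
  \<open>signature_flip\<close> for a rejection, both outcomes of an update land in the same
  class.\<close>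

lemma signature_move:
  assumes "v \<in> signs"
  shows "signature (move {i} x v, v) = flip {i} (signature (x, v))"
proof -
  have "odd (v $ i)" using assms unfolding mem_signs by (metis even_minus odd_one)
  then show ?thesis by (auto simp: vec_eq_iff)
qed

lemma markov_coord_op: "markov_on (sig_class s) (sig_class (flip {i} s)) (coord_op U i)"
  unfolding markov_on_def
proof
  fix z :: "'a state" assume "z \<in> sig_class s"
  then obtain x v where z: "z = (x, v)" "v \<in> signs" "signature (x, v) = s"
    by (cases z) (auto simp: sig_class_def)
  define h where "h b = (if b then (move {i} x v, v) else (x, flip {i} v))" for b
  define p where "p = map_pmf h (bernoulli_pmf (accept U i x (v $ i)))"
  have "set_pmf p \<subseteq> sig_class (flip {i} s)" "finite (set_pmf p)"
    using z by (auto simp: p_def h_def sig_class_def signature_move signature_flip)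
  moreover have "coord_op U i f z = measure_pmf.expectation p f" for f
    unfolding p_def z coord_op_def by (simp add: h_def)
  ultimately show "\<exists>p. finite (set_pmf p) \<and> set_pmf p \<subseteq> sig_class (flip {i} s) \<and>
       (\<forall>f. coord_op U i f z = measure_pmf.expectation p f)" by blast
qed

lemma markov_sweep: "markov_on (sig_class s) (sig_class (flip A s)) (sweep U A)"
  using finite[of A]
proof (induction A rule: finite_linorder_max_induct)
  case (insert b A)
  have "flip {b} (flip A s) = flip (insert b A) s" using insert by (auto simp: vec_eq_iff)
  then show ?case
    using markov_on_comp[OF insert(3) markov_coord_op[of "flip A s" b U]] insert by (simp add: sweep_insert comp_def)
qed (simp_all add: sweep_empty markov_on_id[unfolded id_def] id_def)

lemma markov_on_cong:
  assumes "markov_on S S' T" "\<And>f z. z \<in> S \<Longrightarrow> T f z = T' f z"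
  shows "markov_on S S' T'"
  using assms unfolding markov_on_def by metis

lemma markov_zz_op: "markov_on (sig_class s) (sig_class (flip UNIV s)) (zz_op U)"
  by (rule markov_on_cong[OF markov_sweep]) (auto simp: zz_op_eq_sweep sig_class_def)

lemma funpow_2_times: "(T :: 'a \<Rightarrow> 'a) ^^ (2 * n) = (T \<circ> T) ^^ n"
  by (induction n) auto

lemma markov_zz_op_two: "markov_on (sig_class s) (sig_class s) (zz_op U \<circ> zz_op U)"
  using markov_on_comp[OF markov_zz_op markov_zz_op, of s U U] by (simp add: flip_flip)

lemma markov_on_states:
  assumes "\<And>s. markov_on (sig_class s) (sig_class (\<phi> s)) T"
  shows "markov_on states states T"
  unfolding markov_on_def
proof
  fix z :: "'a state" assume "z \<in> states"
  then have "z \<in> sig_class (signature z)" by (simp add: sig_class_def)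
  from markov_onE[OF assms this] obtain p where "finite (set_pmf p)"
      "set_pmf p \<subseteq> sig_class (\<phi> (signature z))" "\<And>f. T f z = measure_pmf.expectation p f"
    by blast
  then show "\<exists>p. finite (set_pmf p) \<and> set_pmf p \<subseteq> states \<and> (\<forall>f. T f z = measure_pmf.expectation p f)"
    using sig_class_subset by (intro exI[of _ p]) blast
qed

text \<open>For fixed x, multiplying each entry by its parity sign is an involution, so
  \<open>signature\<close> at x is its own inverse.\<close>

lemma sig_velocity:
  assumes "s \<in> signs"
  shows "velocity x s = signature (x, s)"
  unfolding velocity_def
proof (rule the_equality)
  fix v :: "int ^ 'a" assume "v \<in> signs \<and> signature (x, v) = s"
  then have "s = signature (x, v)" by simp
  then show "v = signature (x, s)" by (simp add: vec_eq_iff)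
qed (use assms in \<open>simp add: vec_eq_iff\<close>)

section \<open>Invariance of the Gibbs measure\<close>

lemma gibbs_nonneg: "gibbs U x \<ge> 0"
  unfolding gibbs_def by (intro divide_nonneg_nonneg infsum_nonneg) auto

text \<open>This is detailed balance for the Metropolis rule: the right side is symmetric in x and
  its neighbour.\<close>

lemma gibbs_balance:
  "gibbs U x * accept U i x a = min (gibbs U x) (gibbs U (x + a *s axis i 1))"
proof -
  have Z: "(\<Sum>\<^sub>\<infinity>y. exp (- U y)) \<ge> 0" by (intro infsum_nonneg) auto
  have "exp (- U x) * accept U i x a = min (exp (- U x)) (exp (- U (x + a *s axis i 1)))"
    by (auto simp: accept_def max_def min_def exp_add[symmetric])
  then show ?thesis using Z unfolding gibbs_def
    by (metis (no_types, lifting) min_divide_distrib_right times_divide_eq_left)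
qed

text \<open>\<open>signature (x, s)\<close> plays the role of \<open>v(x, s)\<close>, see \<open>sig_velocity\<close>.\<close>

lemma coord_op_invariant:
  fixes f :: "'d::{finite,linorder} state \<Rightarrow> real"
  assumes s: "s \<in> signs"
    and f: "((\<lambda>x. gibbs U x * f (x, signature (x, flip {i} s))) has_sum I) UNIV"
  shows "((\<lambda>x. gibbs U x * coord_op U i f (x, signature (x, s))) has_sum I) UNIV"
proof -
  \<comment> \<open>\<tau> sends x to the neighbour to which the velocity of the class points; the
    move changes the parity, so the neighbour points back.\<close>
  define \<tau> where "\<tau> x = move {i} x (signature (x, s))" for x
  define F where "F y = f (y, signature (y, flip {i} s))" for y
  define m where "m x = min (gibbs U x) (gibbs U (\<tau> x))" for x
  have odd: "odd (s $ j)" for j using s unfolding mem_signs by (metis even_minus odd_one)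
  have tau: "\<tau> (\<tau> x) = x" for x using odd[of i] by (auto simp: \<tau>_def vec_eq_iff)
  have F1: "f (\<tau> x, signature (x, s)) = F (\<tau> x)" for x
  proof -
    have "signature (x, s) = signature (\<tau> x, flip {i} s)"
      using odd[of i] by (auto simp: \<tau>_def vec_eq_iff)
    then show ?thesis by (simp add: F_def)
  qed
  have F2: "f (x, flip {i} (signature (x, s))) = F x" for x
    by (simp add: F_def signature_flip)
  have m: "gibbs U x * accept U i x (signature (x, s) $ i) = m x" for x
    unfolding gibbs_balance m_def \<tau>_def move_singleton ..
  \<comment> \<open>Mass m x crosses to the neighbour and gibbs U x - m x stays. Since m is
    \<tau>-invariant, reindexing the crossing term by \<tau> makes it cancel against - m x * F x in
    the sum.\<close>
  have eq: "gibbs U x * coord_op U i f (x, signature (x, s)) = m x * F (\<tau> x) + (gibbs U x * F x - m x * F x)" for x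
    unfolding coord_op_def split F2 F1[unfolded \<tau>_def] m[symmetric] \<tau>_def by (simp add: algebra_simps)
  have gF: "((\<lambda>x. gibbs U x * F x) has_sum I) UNIV" using f by (simp add: F_def)
  have "(\<lambda>x. m x * F x) summable_on UNIV"
  proof (rule summable_on_iff_abs_summable_on_real[THEN iffD2], rule Infinite_Sum.abs_summable_on_comparison_test)
    show "(\<lambda>x. norm (gibbs U x * F x)) summable_on UNIV"
      using gF by (intro summable_on_iff_abs_summable_on_real[THEN iffD1] has_sum_imp_summable)
    show "norm (m x * F x) \<le> norm (gibbs U x * F x)" for x
      using gibbs_nonneg[of U x] gibbs_nonneg[of U "\<tau> x"]
      by (auto simp: m_def abs_mult intro!: mult_right_mono)
  qed
  then obtain J where J: "((\<lambda>x. m x * F x) has_sum J) UNIV" by (auto simp: summable_on_def)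
  moreover have "((\<lambda>x. m x * F (\<tau> x)) has_sum J) UNIV \<longleftrightarrow> ((\<lambda>x. m x * F x) has_sum J) UNIV"
    by (rule has_sum_reindex_bij_witness[where i = \<tau> and j = \<tau>]) (auto simp: tau m_def min.commute)
  ultimately have "((\<lambda>x. m x * F (\<tau> x) + (gibbs U x * F x - m x * F x)) has_sum (J + (I - J))) UNIV"
    using gF unfolding diff_conv_add_uminus by (intro has_sum_add has_sum_uminusI) auto
  then show ?thesis by (simp add: eq)
qed

lemma sweep_invariant:
  fixes f :: "'d::{finite,linorder} state \<Rightarrow> real"
  assumes "s \<in> signs" "((\<lambda>x. gibbs U x * f (x, signature (x, flip A s))) has_sum I) UNIV"
  shows "((\<lambda>x. gibbs U x * sweep U A f (x, signature (x, s))) has_sum I) UNIV"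
  using finite[of A] assms(2)
proof (induction A arbitrary: f rule: finite_linorder_max_induct)
  case (insert b A)
  have "flip {b} (flip A s) = flip (insert b A) s" using insert by (auto simp: vec_eq_iff)
  then show ?case
    using insert assms(1) by (auto simp: sweep_insert intro!: insert.IH coord_op_invariant)
qed (simp add: sweep_empty)

lemma zz_op_invariant:
  fixes f :: "'d::{finite,linorder} state \<Rightarrow> real"
  assumes "s \<in> signs" "((\<lambda>x. gibbs U x * f (x, signature (x, flip UNIV s))) has_sum I) UNIV"
  shows "((\<lambda>x. gibbs U x * zz_op U f (x, signature (x, s))) has_sum I) UNIV"
  using sweep_invariant[OF assms] assms(1) by (simp add: zz_op_eq_sweep)

lemma zz_op_even_power_invariant:
  fixes f :: "'d::{finite,linorder} state \<Rightarrow> real"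
  assumes "s \<in> signs" "((\<lambda>x. gibbs U x * f (x, signature (x, s))) has_sum I) UNIV"
  shows "((\<lambda>x. gibbs U x * ((zz_op U \<circ> zz_op U) ^^ n) f (x, signature (x, s))) has_sum I) UNIV"
proof (induction n)
  case (Suc n)
  have "flip UNIV (flip UNIV s) = s" by (simp add: flip_flip)
  then show ?case using Suc assms(1) by (auto intro!: zz_op_invariant)
qed (use assms in simp)

section \<open>The drift condition\<close>

text \<open>The factor 4 for outward velocities is needed: for small \<open>h\<close>, one or two steps of the walk
  may fail to contract \<open>lyapunov h\<close> itself.\<close>

definition coord_weight :: "real \<Rightarrow> 'd \<Rightarrow> 'd::finite state \<Rightarrow> real" where
  "coord_weight h i = (\<lambda>(x, v). exp (h * \<bar>real_of_int (x $ i)\<bar> / 2) * (if v $ i * x $ i > 0 then 4 else 1))"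

definition weight :: "real \<Rightarrow> 'd::finite state \<Rightarrow> real" where
  "weight h z = (\<Sum>i\<in>UNIV. coord_weight h i z)"

lemma coord_weight_nonneg: "coord_weight h i z \<ge> 0"
  by (auto simp: coord_weight_def split: prod.split)

lemma weight_nonneg: "weight h z \<ge> 0"
  unfolding weight_def by (intro sum_nonneg coord_weight_nonneg)

lemma lyapunov_le_weight: "lyapunov h z \<le> weight h z"
  and weight_le_lyapunov: "weight h z \<le> 4 * lyapunov h z"
  by (cases z, auto simp: lyapunov_def weight_def coord_weight_def sum_distrib_left intro!: sum_mono)+

lemma lyapunov_ge_1:
  assumes "h \<ge> 0"
  shows "lyapunov h (x, v :: int ^ 'd::finite) \<ge> 1"
proof -
  have "(\<Sum>i\<in>(UNIV :: 'd set). 1) \<le> lyapunov h (x, v)"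
    unfolding lyapunov_def split using assms by (intro sum_mono) auto
  moreover have "(1 :: real) \<le> (\<Sum>i\<in>(UNIV :: 'd set). 1)" by (simp add: Suc_leI)
  ultimately show ?thesis by linarith
qed

section \<open>Growth of U, acceptance far from the origin and the resulting drift\<close>

locale zig_zag =
  fixes U :: "int ^ 'd::{finite,linorder} \<Rightarrow> real" and R h :: real
  assumes summable: "(\<lambda>x. exp (- U x)) summable_on UNIV"
    and R_pos: "R > 0" and h_pos: "h > 0"
    and growth: "\<And>i x v. v \<in> signs \<Longrightarrow>
      max (U (x + v $ i *s axis i 1) - U x) 0 \<ge> h * of_bool (real_of_int (v $ i * x $ i) > R)"
begin

lemma growth_outward:
  assumes "v \<in> signs" "real_of_int (v $ i * x $ i) > R"
  shows "U (move {i} x v) \<ge> U x + h"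
  using growth[of v i x] assms h_pos by (auto simp: move_singleton max_def split: if_splits)

lemma accept_outward:
  assumes "v \<in> signs" "real_of_int (v $ i * x $ i) > R"
  shows "accept U i x (v $ i) \<le> exp (- h)"
  using growth[of v i x] assms unfolding accept_def by simp

text \<open>The landing point is still beyond R, hence the extra 1 in the threshold. There the
  growth hypothesis for the reversed velocity says that stepping back raises U, so the inward step
  lowers it.\<close>

lemma accept_inward:
  assumes v: "v \<in> signs" and x: "real_of_int (v $ i * x $ i) < - (R + 1)"
  shows "accept U i x (v $ i) = 1"
proof -
  define y where "y = move {i} x v"
  have vi: "v $ i * v $ i = 1" using v unfolding mem_signs by (metis mult_minus_left mult_minus_right mult_1 minus_minus)
  have "flip UNIV v $ i * y $ i = - (v $ i * x $ i) - v $ i * v $ i"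
    by (simp add: y_def algebra_simps)
  also have "\<dots> = - (v $ i * x $ i) - 1" unfolding vi ..
  finally have "real_of_int (flip UNIV v $ i * y $ i) > R" using x by simp
  from growth_outward[OF _ this] have "U (move {i} y (flip UNIV v)) \<ge> U y + h" using v by simp
  also have "move {i} y (flip UNIV v) = x" by (simp add: y_def vec_eq_iff)
  finally show ?thesis using h_pos unfolding accept_def y_def move_singleton by simp
qed

text \<open>The factor by which the weight shrinks per unit of distance; outward acceptance beyond R
  is at most its square.\<close>

definition \<theta> :: real where "\<theta> = exp (- h / 2)"

lemma theta: "0 < \<theta>" "\<theta> < 1" "\<theta> * \<theta> = exp (- h)"
  using h_pos by (auto simp: \<theta>_def exp_add[symmetric])

lemma exp_shift: "exp (h * (a + 1) / 2) * \<theta> = exp (h * a / 2)"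
  by (simp add: \<theta>_def exp_add[symmetric] algebra_simps add_divide_distrib[symmetric])

text \<open>It exceeds \<theta>, as inward moves require. The outward case requires 4 * \<gamma>
  \<ge> 1 + 4 * \<theta> - \<theta>^2, which holds with slack (1 - \<theta>)^2.\<close>

definition \<gamma> :: real where "\<gamma> = (1 + \<theta>) / 2"

lemma gamma: "0 \<le> \<gamma>" "\<gamma> < 1"
  using theta by (auto simp: \<gamma>_def)

text \<open>Dominates the weight, factor 4 included, at one step from the zone where x $ i has
  modulus at most R + 1.\<close>

definition C0 :: real where "C0 = 4 * exp (h * (R + 2) / 2)"

text \<open>Far out and outwards, the weight 4 * E becomes 4 * E / \<theta> with probability q \<le>
  \<theta>^2 and drops to E on turning. Far out and inwards, the move is certain and gains a factor
  \<theta>. Near the origin \<open>C0\<close> dominates.\<close>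

lemma coord_drift:
  assumes "z \<in> states"
  shows "coord_op U i (coord_weight h i) z \<le> \<gamma> * coord_weight h i z + C0"
proof -
  obtain x v where z: "z = (x, v)" "v \<in> signs" using assms by (cases z) auto
  define q where "q = accept U i x (v $ i)"
  have q: "0 \<le> q" "q \<le> 1" by (auto simp: q_def)
  have v: "v $ i = 1 \<or> v $ i = - 1" using z by (simp add: mem_signs)
  define E where "E = exp (h * \<bar>real_of_int (x $ i)\<bar> / 2)"
  have E: "E > 0" by (simp add: E_def)
  let ?W = "coord_weight h i"
  have op: "coord_op U i ?W z = q * ?W (move {i} x v, v) + (1 - q) * ?W (x, flip {i} v)"
    by (simp add: z coord_op_def q_def)
  consider "\<bar>real_of_int (x $ i)\<bar> \<le> R + 1"
    | "\<bar>real_of_int (x $ i)\<bar> > R + 1" "v $ i * x $ i > 0"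
    | "\<bar>real_of_int (x $ i)\<bar> > R + 1" "v $ i * x $ i \<le> 0" by linarith
  then show ?thesis
  proof cases
    case 1
    have bd: "?W (y, u) \<le> C0" if "\<bar>real_of_int (y $ i)\<bar> \<le> R + 2" for y u
    proof -
      have "exp (h * \<bar>real_of_int (y $ i)\<bar> / 2) \<le> exp (h * (R + 2) / 2)"
        using that h_pos by simp
      then have "4 * exp (h * \<bar>real_of_int (y $ i)\<bar> / 2) \<le> C0" unfolding C0_def by linarith
      moreover have "?W (y, u) \<le> 4 * exp (h * \<bar>real_of_int (y $ i)\<bar> / 2)" by (simp add: coord_weight_def)
      ultimately show ?thesis by linarith
    qed
    have "q * ?W (move {i} x v, v) + (1 - q) * ?W (x, flip {i} v) \<le> q * C0 + (1 - q) * C0"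
      using 1 q v by (intro add_mono mult_left_mono bd) auto
    also have "\<dots> = C0" by (simp add: algebra_simps)
    finally show ?thesis
      unfolding op using mult_nonneg_nonneg[OF gamma(1) coord_weight_nonneg[of h i z]] by linarith
  next
    case 2
    have vx: "v $ i * x $ i = \<bar>x $ i\<bar>" using 2 v by auto
    have "q \<le> \<theta> * \<theta>"
      unfolding theta q_def using 2 z(2) by (intro accept_outward) (auto simp: vx)
    moreover have pos: "v $ i * (x $ i + v $ i) > 0" using 2 v by auto
    have ab: "\<bar>real_of_int (x $ i + v $ i)\<bar> = \<bar>real_of_int (x $ i)\<bar> + 1" using 2 v by auto
    have "?W (move {i} x v, v) = exp (h * (\<bar>real_of_int (x $ i)\<bar> + 1) / 2) * 4"
      unfolding coord_weight_def split move_nth using pos by (simp only: singleton_iff simp_thms if_True ab)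
    then have "?W (move {i} x v, v) * \<theta> = 4 * E"
      using exp_shift[of "\<bar>real_of_int (x $ i)\<bar>"] by (simp add: E_def)
    then have "?W (move {i} x v, v) = 4 * E / \<theta>" using theta by (simp add: field_simps)
    moreover have "?W (x, flip {i} v) = E" "?W z = 4 * E"
      using 2 by (auto simp: coord_weight_def E_def z)
    ultimately have "coord_op U i ?W z = E * (1 + q * (4 / \<theta> - 1))" "q \<le> \<theta> * \<theta>" "?W z = 4 * E"
      unfolding op by (auto simp: algebra_simps)
    note this(1)
    \<comment> \<open>The expression increases with q because 4 / \<theta> > 1.\<close>
    also have "E * (1 + q * (4 / \<theta> - 1)) \<le> E * (1 + \<theta> * \<theta> * (4 / \<theta> - 1))"
      using E theta \<open>q \<le> \<theta> * \<theta>\<close> by (intro mult_left_mono add_left_mono mult_right_mono) (auto simp: field_simps)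
    also have "1 + \<theta> * \<theta> * (4 / \<theta> - 1) = \<gamma> * 4 - (1 - \<theta>)\<^sup>2"
      using theta by (simp add: \<gamma>_def field_simps power2_eq_square)
    also have "E * (\<gamma> * 4 - (1 - \<theta>)\<^sup>2) \<le> E * (\<gamma> * 4)" using E by (intro mult_left_mono) auto
    also have "\<dots> \<le> \<gamma> * ?W z + C0" unfolding \<open>?W z = 4 * E\<close> C0_def by simp
    finally show ?thesis .
  next
    case 3
    have "R + 1 > 0" using R_pos by simp
    then have x0: "x $ i \<noteq> 0" using 3 by auto
    have vx: "v $ i * x $ i = - \<bar>x $ i\<bar>" using 3 x0 v by auto
    have "q = 1" unfolding q_def using 3 z(2) by (intro accept_inward) (auto simp: vx)
    \<comment> \<open>The step does not pass the origin, so the velocity is still not outward and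
      the factor 4 stays absent.\<close>
    moreover have pos: "\<not> v $ i * (x $ i + v $ i) > 0" using 3 v x0 by auto
    have ab: "\<bar>real_of_int (x $ i)\<bar> = \<bar>real_of_int (x $ i + v $ i)\<bar> + 1" using 3 v x0 by auto
    have "?W (move {i} x v, v) = exp (h * \<bar>real_of_int (x $ i + v $ i)\<bar> / 2)"
      unfolding coord_weight_def split move_nth using pos by (simp only: singleton_iff simp_thms if_True if_False mult_1_right)
    then have "?W (move {i} x v, v) = E * \<theta>"
      unfolding E_def ab by (simp only: exp_shift)
    moreover have "?W z = E" using 3 by (auto simp: coord_weight_def E_def z)
    moreover have "E * \<theta> \<le> E * \<gamma>" using E theta by (simp add: \<gamma>_def)
    moreover have "C0 \<ge> 0" by (simp add: C0_def)
    ultimately show ?thesis unfolding op by (simp add: mult.commute)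
  qed
qed

lemma coord_op_other: "b \<noteq> i \<Longrightarrow> coord_op U b (coord_weight h i) = coord_weight h i"
  by (auto simp: coord_op_def coord_weight_def fun_eq_iff algebra_simps)

lemma markov_sweep_states: "markov_on states states (sweep U A)"
  by (rule markov_on_states[OF markov_sweep])

lemma sweep_other: "i \<notin> A \<Longrightarrow> sweep U A (coord_weight h i) = coord_weight h i"
  using finite[of A]
proof (induction A rule: finite_linorder_max_induct)
  case (insert b A)
  then show ?case by (auto simp: sweep_insert coord_op_other)
qed (simp add: sweep_empty)

text \<open>Only the update of i affects this weight: later updates fix it and earlier ones pass it
  through, so a single use of \<open>coord_drift\<close> settles the sweep.\<close>

lemma sweep_drift:
  assumes "i \<in> A" "z \<in> states"
  shows "sweep U A (coord_weight h i) z \<le> \<gamma> * coord_weight h i z + C0"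
  using finite[of A] assms(1)
proof (induction A rule: finite_linorder_max_induct)
  case (insert b A)
  show ?case
  proof (cases "b = i")
    case True
    then have iA: "i \<notin> A" using insert by auto
    have "sweep U (insert b A) (coord_weight h i) z = sweep U A (coord_op U i (coord_weight h i)) z"
      using insert True by (simp add: sweep_insert)
    also have "\<dots> \<le> sweep U A (\<lambda>z. \<gamma> * coord_weight h i z + C0) z"
      by (intro markov_on_mono[OF markov_sweep_states assms(2)] coord_drift)
    also have "\<dots> = \<gamma> * sweep U A (coord_weight h i) z + C0"
      by (rule markov_on_affine[OF markov_sweep_states assms(2)])
    finally show ?thesis using sweep_other[OF iA] by simp
  next
    case False
    then show ?thesis using insert by (simp add: sweep_insert coord_op_other)
  qed
qed simp

lemma zz_drift:
  assumes "z \<in> states"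
  shows "zz_op U (weight h) z \<le> \<gamma> * weight h z + CARD('d) * C0"
proof -
  have "zz_op U (weight h) z = (\<Sum>i\<in>UNIV. sweep U UNIV (coord_weight h i) z)"
    unfolding zz_op_eq_sweep[OF assms] weight_def
    by (rule markov_on_sum[OF markov_sweep_states assms])
  also have "\<dots> \<le> (\<Sum>i\<in>UNIV. \<gamma> * coord_weight h i z + C0)"
    using assms by (intro sum_mono sweep_drift) auto
  finally show ?thesis by (simp add: sum.distrib weight_def sum_distrib_left)
qed

section \<open>Integrability of the weight\<close>

text \<open>Far out, pushing coordinate i one unit towards 0 multiplies exp(-U) by at least exp(h)
  and the weight by \<theta>, so G x \<le> \<theta> * G (inw x). The push is injective there and
  preserves boxes, so a box sum S satisfies S \<le> K * Z + \<theta> * S.\<close>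

lemma exp_weight_summable:
  "(\<lambda>x. exp (- U x) * exp (h * \<bar>real_of_int (x $ i)\<bar> / 2)) summable_on UNIV"
proof -
  define G where "G = (\<lambda>x. exp (- U x) * exp (h * \<bar>real_of_int (x $ i)\<bar> / 2))"
  define Z where "Z = (\<Sum>\<^sub>\<infinity>x. exp (- U x))"
  define K where "K = exp (h * (R + 1) / 2)"
  define inw :: "int ^ 'd::{finite,linorder} \<Rightarrow> int ^ 'd::{finite,linorder}" where "inw x = (\<chi> j. if j = i then x $ j - sgn (x $ j) else x $ j)" for x
  have G0: "G x \<ge> 0" for x by (simp add: G_def)
  have near: "G x \<le> K * exp (- U x)" if "\<bar>real_of_int (x $ i)\<bar> \<le> R + 1" for x
  proof -
    have "exp (h * \<bar>real_of_int (x $ i)\<bar> / 2) \<le> K" unfolding K_def using that h_pos by simp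
    then show ?thesis unfolding G_def by (simp add: mult.commute)
  qed
  have far: "G x \<le> \<theta> * G (inw x)" if x: "\<bar>real_of_int (x $ i)\<bar> > R + 1" for x
  proof -
    have x0: "x $ i \<noteq> 0" using x R_pos by auto
    define v :: "int ^ 'd::{finite,linorder}" where "v = (\<chi> j. sgn (x $ i))"
    have v: "v \<in> signs" using x0 by (auto simp: mem_signs v_def sgn_if)
    have ab: "\<bar>x $ i\<bar> = \<bar>inw x $ i\<bar> + 1" using x0 by (auto simp: inw_def sgn_if)
    have "v $ i * inw x $ i = \<bar>x $ i\<bar> - 1" using x0 by (auto simp: inw_def v_def sgn_if)
    then have "U (move {i} (inw x) v) \<ge> U (inw x) + h"
      using x v by (intro growth_outward) auto
    also have "move {i} (inw x) v = x" by (auto simp: vec_eq_iff inw_def v_def)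
    finally have "exp (- U x) \<le> exp (- U (inw x) + (- h))" by simp
    also have "\<dots> = exp (- U (inw x)) * (\<theta> * \<theta>)" by (simp only: exp_add theta)
    finally have "G x \<le> exp (- U (inw x)) * (\<theta> * \<theta>) * exp (h * \<bar>real_of_int (x $ i)\<bar> / 2)"
      unfolding G_def by (intro mult_right_mono) auto
    also have "real_of_int \<bar>x $ i\<bar> = real_of_int \<bar>inw x $ i\<bar> + 1" unfolding ab by simp
    then have "exp (h * \<bar>real_of_int (x $ i)\<bar> / 2) * \<theta> = exp (h * \<bar>real_of_int (inw x $ i)\<bar> / 2)"
      using exp_shift[of "\<bar>real_of_int (inw x $ i)\<bar>"] by simp
    then have "exp (- U (inw x)) * (\<theta> * \<theta>) * exp (h * \<bar>real_of_int (x $ i)\<bar> / 2) = \<theta> * G (inw x)"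
      unfolding G_def by (metis (no_types, opaque_lifting) mult.assoc mult.commute)
    finally show ?thesis .
  qed
  \<comment> \<open>A box is finite, so \<theta> * S may be subtracted from both sides. Every finite
    set lies in a box, which bounds all finite sums.\<close>
  have box: "sum G {x. \<forall>j. \<bar>x $ j\<bar> \<le> b} \<le> K * Z / (1 - \<theta>)" for b
  proof -
    let ?B = "{x :: int ^ 'd::{finite,linorder}. \<forall>j. \<bar>x $ j\<bar> \<le> b}"
    let ?N = "{x \<in> ?B. \<bar>real_of_int (x $ i)\<bar> \<le> R + 1}" and ?F = "{x \<in> ?B. \<not> \<bar>real_of_int (x $ i)\<bar> \<le> R + 1}"
    have fin: "finite ?B" by (rule finite_vec_bounded)
    have inj: "inj_on inw ?F"
    proof (rule inj_onI)
      fix x y assume "x \<in> ?F" "y \<in> ?F" and eq: "inw x = inw y"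
      \<comment> \<open>From modulus above 1 the push cannot reach 0, so the image still shows the
        sign of the entry.\<close>
      then have "\<bar>x $ i\<bar> > 1" "\<bar>y $ i\<bar> > 1" using R_pos by auto
      moreover have "inw x $ j = inw y $ j" for j using eq by simp
      from this[of i] have "x $ i - sgn (x $ i) = y $ i - sgn (y $ i)" by (simp add: inw_def)
      ultimately have i: "x $ i = y $ i" by (auto simp: sgn_if split: if_splits)
      have "x $ j = y $ j" for j
        using i arg_cong[OF eq, of "\<lambda>z. z $ j"] by (cases "j = i") (auto simp: inw_def)
      then show "x = y" by (simp add: vec_eq_iff)
    qed
    have img: "inw ` ?F \<subseteq> ?B"
    proof clarsimp
      fix x :: "int ^ 'd::{finite,linorder}" and j assume "\<forall>j. \<bar>x $ j\<bar> \<le> b"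
      then have "\<bar>x $ j\<bar> \<le> b" by simp
      then show "\<bar>inw x $ j\<bar> \<le> b" by (auto simp: inw_def sgn_if)
    qed
    have "sum G ?B = sum G (?N \<union> ?F)" by (rule arg_cong[of _ _ "sum G"]) auto
    also have "\<dots> = sum G ?N + sum G ?F" using fin by (intro sum.union_disjoint) auto
    also have "sum G ?N \<le> (\<Sum>x\<in>?N. K * exp (- U x))" by (intro sum_mono near) auto
    also have "\<dots> = K * (\<Sum>x\<in>?N. exp (- U x))" by (simp add: sum_distrib_left)
    also have "\<dots> \<le> K * Z"
      unfolding Z_def K_def using fin summable by (intro mult_left_mono finite_sum_le_infsum) auto
    also have "sum G ?F \<le> (\<Sum>x\<in>?F. \<theta> * G (inw x))" by (intro sum_mono far) auto
    also have "\<dots> = \<theta> * sum G (inw ` ?F)" unfolding sum.reindex[OF inj] sum_distrib_left by (simp add: comp_def)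
    also have "\<dots> \<le> \<theta> * sum G ?B"
      using theta fin img G0 by (intro mult_left_mono sum_mono2) auto
    finally show ?thesis using theta by (simp add: field_simps)
  qed
  have "G summable_on UNIV"
  proof (rule nonneg_bdd_above_summable_on)
    show "bdd_above (sum G ` {F. F \<subseteq> UNIV \<and> finite F})"
    proof (rule bdd_aboveI, clarify)
      fix F :: "(int ^ 'd::{finite,linorder}) set" assume F: "finite F"
      define b where "b = (\<Sum>x\<in>F. \<Sum>j\<in>UNIV. \<bar>x $ j\<bar>)"
      have "\<bar>x $ j\<bar> \<le> b" if "x \<in> F" for x j
      proof -
        have "\<bar>x $ j\<bar> \<le> (\<Sum>j\<in>UNIV. \<bar>x $ j\<bar>)" by (intro member_le_sum) auto
        also have "\<dots> \<le> b" unfolding b_def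
          using that F by (intro member_le_sum[where f = "\<lambda>x. \<Sum>j\<in>UNIV. \<bar>x $ j\<bar>"]) (auto intro: sum_nonneg)
        finally show ?thesis .
      qed
      then have "sum G F \<le> sum G {x. \<forall>j. \<bar>x $ j\<bar> \<le> b}"
        using G0 by (intro sum_mono2 finite_vec_bounded) auto
      then show "sum G F \<le> K * Z / (1 - \<theta>)" using box[of b] by simp
    qed
  qed (use G0 in auto)
  then show ?thesis by (simp add: G_def)
qed

lemma gibbs_has_sum: "(gibbs U has_sum 1) UNIV"
proof -
  define Z where "Z = (\<Sum>\<^sub>\<infinity>x. exp (- U x))"
  have "sum (\<lambda>x. exp (- U x)) {0} \<le> Z"
    unfolding Z_def using summable by (intro finite_sum_le_infsum) auto
  then have "Z > 0" by simp (smt (verit) exp_gt_zero)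
  moreover have "((\<lambda>x. exp (- U x)) has_sum Z) UNIV" using summable by (simp add: Z_def)
  from has_sum_divide_const[OF this, of Z] have "((\<lambda>x. exp (- U x) / Z) has_sum (Z / Z)) UNIV" .
  moreover have "gibbs U = (\<lambda>x. exp (- U x) / Z)" by (auto simp: gibbs_def Z_def)
  ultimately show ?thesis by simp
qed

lemma gibbs_lyapunov_summable: "(\<lambda>x. gibbs U x * lyapunov h (x, v x)) summable_on UNIV"
proof -
  let ?g = "\<lambda>i x. exp (- U x) * exp (h * \<bar>real_of_int (x $ i)\<bar> / 2)"
  have "(\<lambda>x. \<Sum>i\<in>I. ?g i x) summable_on UNIV" for I
    by (induction I rule: infinite_finite_induct) (simp_all add: summable_on_add exp_weight_summable)
  from summable_on_cmult_right[OF this[of UNIV], of "1 / (\<Sum>\<^sub>\<infinity>x. exp (- U x))"] show ?thesis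
    by (simp add: gibbs_def lyapunov_def sum_distrib_left)
qed

end

section \<open>Reachability and minorization\<close>

text \<open>Pairs (position, velocity) of one coordinate; these transitions have positive probability
  whatever the other coordinates are.\<close>

definition coord_step :: "real \<Rightarrow> ((int \<times> int) \<times> (int \<times> int)) set" where
  "coord_step R = {((a, u), (a', u')). a' = a + u \<and> u' = u \<or> a' = a \<and> u' = - u \<and> real_of_int (u * a) > R}"

lemma coord_step_straight: "((a, u), (a + int k * u, u)) \<in> coord_step R ^^ k"
proof (induction k)
  case (Suc k)
  have "((a + int k * u, u), (a + int (Suc k) * u, u)) \<in> coord_step R"
    by (simp add: coord_step_def algebra_simps)
  with Suc show ?case by (rule relpow_Suc_I)
qed simp

text \<open>Go straight for \<open>k\<close> steps, turn at a point far outside, and come back to \<open>b\<close>.\<close>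

lemma coord_step_turn:
  assumes u: "u = 1 \<or> u = - 1"
  shows "\<exists>T0. \<forall>T\<ge>T0. odd (int T - (a - b)) \<longrightarrow> ((a, u), (b, - u)) \<in> coord_step R ^^ T"
proof (intro exI allI impI)
  define K where "K = nat (\<bar>\<lceil>R\<rceil>\<bar> + \<bar>a\<bar> + \<bar>b\<bar> + 1)"
  fix T assume T: "T \<ge> 2 * K + 1 + nat (\<bar>a\<bar> + \<bar>b\<bar>)" and odd: "odd (int T - (a - b))"
  \<comment> \<open>After k steps out, a turn and m steps back the position is b if m = k + u * (a -
    b). Solving k + 1 + m = T for k gives this value; the parity assumption makes the division
    exact, and \<open>K\<close> ensures that the turn lies beyond R and that m is
    nonnegative.\<close>
  define k where "k = nat ((int T - 1 - u * (a - b)) div 2)"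
  define m where "m = nat (int k + u * (a - b))"
  have uu: "u * u = 1" using u by auto
  have ub: "\<bar>u * (a - b)\<bar> \<le> \<bar>a\<bar> + \<bar>b\<bar>" "\<bar>u * a\<bar> = \<bar>a\<bar>" using u by auto
  have even: "even (int T - 1 - u * (a - b))" using odd u by auto
  have "int T - 1 - u * (a - b) \<ge> 2 * int K" using T ub(1) by simp
  then have k: "int T = 2 * int k + 1 + u * (a - b)" "k \<ge> K"
    using even unfolding k_def by auto
  have m: "int m = int k + u * (a - b)" using k(2) ub(1) unfolding m_def K_def by simp
  have Tm: "T = k + Suc m" using k(1) m by simp
  have "u * (a + int k * u) = u * a + int k" using uu by (simp add: algebra_simps)
  moreover have "int k > \<bar>\<lceil>R\<rceil>\<bar> + \<bar>u * a\<bar>" using k(2) unfolding ub(2) K_def by simp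
  ultimately have "u * (a + int k * u) > \<lceil>R\<rceil>" by linarith
  then have "((a + int k * u, u), (a + int k * u, - u)) \<in> coord_step R"
    unfolding coord_step_def by (auto simp: ceiling_less_iff less_ceiling_iff)
  moreover have "a + int k * u + int m * - u = b"
  proof -
    have "a + int k * u + int m * - u = a - (u * u) * (a - b)" unfolding m by (simp add: algebra_simps)
    then show ?thesis using uu by simp
  qed
  then have "((a + int k * u, - u), (b, - u)) \<in> coord_step R ^^ m"
    using coord_step_straight[of "a + int k * u" "- u" m R] by simp
  ultimately have "((a + int k * u, u), (b, - u)) \<in> coord_step R ^^ Suc m"
    by (rule relpow_Suc_I2)
  with coord_step_straight[of a u k R] show "((a, u), (b, - u)) \<in> coord_step R ^^ T"
    unfolding Tm relpow_add by (rule relcompI)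
qed

text \<open>T counts moves and turns, and the moves have the parity of a. For even T so do the
  turns: one excursion is used for odd a, two for even a.\<close>

lemma coord_step_reach_0:
  assumes u: "u = 1 \<or> u = - 1"
  shows "\<exists>T0. \<forall>T\<ge>T0. even T \<longrightarrow> ((a, u), (0, if even a then u else - u)) \<in> coord_step R ^^ T"
proof (cases "even a")
  case False
  obtain T0 where "\<And>T. T \<ge> T0 \<Longrightarrow> odd (int T - (a - 0)) \<Longrightarrow> ((a, u), (0, - u)) \<in> coord_step R ^^ T"
    using coord_step_turn[OF u, of a 0 R] by blast
  then show ?thesis using False by (intro exI[of _ T0]) auto
next
  case True
  obtain T1 where T1: "\<And>T. T \<ge> T1 \<Longrightarrow> odd (int T - (a - 0)) \<Longrightarrow> ((a, u), (0, - u)) \<in> coord_step R ^^ T"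
    using coord_step_turn[OF u, of a 0 R] by blast
  obtain T2 where T2: "\<And>T. T \<ge> T2 \<Longrightarrow> odd (int T - (0 - 0)) \<Longrightarrow> ((0, - u), (0, - (- u))) \<in> coord_step R ^^ T"
    using coord_step_turn[of "- u" 0 0 R] u by auto
  show ?thesis
  proof (intro exI allI impI)
    fix T assume T: "T \<ge> 2 * T1 + 1 + T2" "even T"
    \<comment> \<open>The first excursion takes a fixed odd time; the second absorbs the remaining
      time, which is odd as well.\<close>
    have "((a, u), (0, - u)) \<in> coord_step R ^^ (2 * T1 + 1)" using True by (intro T1) auto
    moreover have "((0, - u), (0, - (- u))) \<in> coord_step R ^^ (T - (2 * T1 + 1))" using T by (intro T2) auto
    ultimately have "((a, u), (0, - (- u))) \<in> coord_step R ^^ (2 * T1 + 1 + (T - (2 * T1 + 1)))"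
      unfolding relpow_add by (rule relcompI)
    then show "((a, u), (0, if even a then u else - u)) \<in> coord_step R ^^ T" using T True by simp
  qed
qed

section \<open>From paths of single coordinates to lower bounds for the walk\<close>

context zig_zag
begin

text \<open>Acceptance is never 0, and beyond R an outward move is rejected with probability at
  least 1 - exp(-h). This threshold involves coordinate i only, so the moves already made by earlier
  coordinates are harmless.\<close>

lemma zz_op_step_ge:
  assumes v: "v \<in> signs"
    and step: "\<And>i. ((x $ i, v $ i), (y $ i, w $ i)) \<in> coord_step R"
  shows "w \<in> signs" "\<exists>c>0. \<forall>g. (\<forall>z\<in>states. g z \<ge> 0) \<longrightarrow> zz_op U g (x, v) \<ge> c * g (y, w)"
proof -
  have v1: "v $ i = 1 \<or> v $ i = - 1" for i using v by (simp add: mem_signs)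
  show w: "w \<in> signs" unfolding mem_signs
  proof
    show "w $ i = 1 \<or> w $ i = - 1" for i using step[of i] v1[of i] by (auto simp: coord_step_def)
  qed
  have y: "x + (\<chi> j. (v $ j + w $ j) div 2) = y"
    unfolding vec_eq_iff
  proof
    show "(x + (\<chi> j. (v $ j + w $ j) div 2)) $ i = y $ i" for i
      using step[of i] v1[of i] by (auto simp: coord_step_def)
  qed
  have nonneg: "coord_prob U i u (v $ i) b \<ge> 0" for i u b
    by (simp add: coord_prob_def)
  then have zz_nonneg: "zz_prob U x v w' \<ge> 0" for w'
    unfolding zz_prob_def by (intro prod_nonneg) auto
  have "zz_prob U x v w > 0"
    unfolding zz_prob_def
  proof (rule prod_pos)
    fix i
    define u where "u = x + (\<Sum>j | j < i. ((v $ j + w $ j) div 2) *s axis j 1)"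
    have ui: "u $ i = x $ i" by (auto simp: u_def axis_def intro!: sum.neutral)
    have v0: "v $ i \<noteq> - v $ i" using v1[of i] by auto
    consider "w $ i = v $ i" | "w $ i = - v $ i" "real_of_int (v $ i * x $ i) > R"
      using step[of i] by (auto simp: coord_step_def)
    then show "coord_prob U i u (v $ i) (w $ i) > 0"
    proof cases
      case 2
      have "accept U i u (v $ i) \<le> exp (- h)" using 2 v ui by (intro accept_outward) auto
      also have "\<dots> < 1" using h_pos by simp
      finally show ?thesis using 2 v0 by (simp add: coord_prob_def)
    qed (use v0 in \<open>simp add: coord_prob_def\<close>)
  qed
  moreover have "zz_op U g (x, v) \<ge> zz_prob U x v w * g (y, w)" if g: "\<forall>z\<in>states. g z \<ge> 0" for g
  proof -
    let ?t = "\<lambda>w'. g (x + (\<chi> j. (v $ j + w' $ j) div 2), w') * zz_prob U x v w'"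
    have "?t w \<le> sum ?t signs"
      using w g zz_nonneg by (intro member_le_sum finite_signs) auto
    then show ?thesis unfolding zz_op_def split y by (simp add: mult.commute)
  qed
  ultimately show "\<exists>c>0. \<forall>g. (\<forall>z\<in>states. g z \<ge> 0) \<longrightarrow> zz_op U g (x, v) \<ge> c * g (y, w)" by blast
qed

lemma markov_zz_op_states: "markov_on states states (zz_op U)"
  by (rule markov_on_states[OF markov_zz_op])

text \<open>The coordinate paths share the length T, so intermediate points chosen separately for
  each coordinate assemble into one state; the constants multiply along the path.\<close>

lemma zz_op_power_ge:
  assumes "v \<in> signs" "\<And>i. ((x $ i, v $ i), (y $ i, w $ i)) \<in> coord_step R ^^ T"
  shows "\<exists>c>0. \<forall>g. (\<forall>z\<in>states. g z \<ge> 0) \<longrightarrow> (zz_op U ^^ T) g (x, v) \<ge> c * g (y, w)"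
  using assms
proof (induction T arbitrary: x v)
  case 0
  then have "x = y" "v = w" by (auto simp: vec_eq_iff)
  then show ?case by (auto intro!: exI[of _ 1])
next
  case (Suc T)
  have "\<exists>p. ((x $ i, v $ i), p) \<in> coord_step R \<and> (p, (y $ i, w $ i)) \<in> coord_step R ^^ T" for i
    using Suc.prems(2)[of i] relpow_Suc_D2 by metis
  then obtain p where p: "\<And>i. ((x $ i, v $ i), p i) \<in> coord_step R"
      "\<And>i. (p i, (y $ i, w $ i)) \<in> coord_step R ^^ T" by metis
  define x' where "x' = (\<chi> i. fst (p i))"
  define v' where "v' = (\<chi> i. snd (p i))"
  have p_eq: "p i = (x' $ i, v' $ i)" for i by (simp add: x'_def v'_def)
  note step = zz_op_step_ge[OF Suc.prems(1) p(1)[unfolded p_eq]]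
  obtain c1 where c1: "c1 > 0"
      "\<And>g. (\<forall>z\<in>states. g z \<ge> 0) \<Longrightarrow> zz_op U g (x, v) \<ge> c1 * g (x', v')"
    using step(2) by blast
  obtain c2 where c2: "c2 > 0"
      "\<And>g. (\<forall>z\<in>states. g z \<ge> 0) \<Longrightarrow> (zz_op U ^^ T) g (x', v') \<ge> c2 * g (y, w)"
    using Suc.IH[OF step(1) p(2)[unfolded p_eq]] by blast
  have "(zz_op U ^^ Suc T) g (x, v) \<ge> c1 * c2 * g (y, w)" if g: "\<forall>z\<in>states. g z \<ge> 0" for g
  proof -
    have "(zz_op U ^^ T) g z \<ge> 0" if z: "z \<in> states" for z
      using markov_on_mono[OF markov_on_power[OF markov_zz_op_states] z, of "\<lambda>_. 0" g T]
        markov_on_const[OF markov_on_power[OF markov_zz_op_states] z, of T 0] g by simp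
    then have "c1 * (zz_op U ^^ T) g (x', v') \<le> (zz_op U ^^ Suc T) g (x, v)"
      using c1(2)[of "(zz_op U ^^ T) g"] by simp
    moreover have "c1 * (c2 * g (y, w)) \<le> c1 * (zz_op U ^^ T) g (x', v')"
      using c1(1) c2(2)[OF g] by (intro mult_left_mono) auto
    ultimately show ?thesis by simp
  qed
  then show ?case using c1(1) c2(1) by (intro exI[of _ "c1 * c2"]) auto
qed

text \<open>Each coordinate can use every large even time, so the largest threshold works for all at
  once. At 0 velocity and signature coincide, which dictates the final velocity.\<close>

lemma reach_center:
  assumes v: "v \<in> signs"
  shows "\<exists>T0. \<forall>T\<ge>T0. even T \<longrightarrow>
    (\<forall>i. ((x $ i, v $ i), (0 $ i, signature (x, v) $ i)) \<in> coord_step R ^^ T)"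
proof -
  have "\<forall>i. \<exists>T0. \<forall>T\<ge>T0. even T \<longrightarrow> ((x $ i, v $ i), (0, signature (x, v) $ i)) \<in> coord_step R ^^ T"
  proof
    fix i
    have "v $ i = 1 \<or> v $ i = - 1" using v by (simp add: mem_signs)
    from coord_step_reach_0[OF this, of "x $ i" R]
    show "\<exists>T0. \<forall>T\<ge>T0. even T \<longrightarrow> ((x $ i, v $ i), (0, signature (x, v) $ i)) \<in> coord_step R ^^ T"
      by simp
  qed
  then obtain T0 where T0: "\<And>i T. T \<ge> T0 i \<Longrightarrow> even T \<Longrightarrow>
      ((x $ i, v $ i), (0, signature (x, v) $ i)) \<in> coord_step R ^^ T" by metis
  have "T0 i \<le> Max (range T0)" for i by simp
  then show ?thesis using T0 by (intro exI[of _ "Max (range T0)"]) (auto intro: order_trans)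
qed

lemma finite_sublevel: "finite {z \<in> (states :: 'd::{finite,linorder} state set). weight h z \<le> r}"
proof -
  define b where "b = \<lceil>2 * r / h\<rceil>"
  have fin: "finite ({x :: int ^ 'd::{finite,linorder}. \<forall>i. \<bar>x $ i\<bar> \<le> b} \<times> (signs :: (int ^ 'd::{finite,linorder}) set))"
    by (intro finite_cartesian_product finite_vec_bounded finite_signs)
  have "{z \<in> states. weight h z \<le> r} \<subseteq> {x. \<forall>i. \<bar>x $ i\<bar> \<le> b} \<times> signs"
  proof clarsimp
    fix x v i assume "weight h (x, v) \<le> r"
    then have "lyapunov h (x, v) \<le> r" using lyapunov_le_weight order_trans by blast
    moreover have "exp (h * \<bar>real_of_int (x $ i)\<bar> / 2) \<le> lyapunov h (x, v)"
      unfolding lyapunov_def split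
      by (intro member_le_sum[where f = "\<lambda>i. exp (h * \<bar>real_of_int (x $ i)\<bar> / 2)"]) auto
    ultimately have "h * \<bar>real_of_int (x $ i)\<bar> / 2 \<le> r"
      using exp_ge_add_one_self[of "h * \<bar>real_of_int (x $ i)\<bar> / 2"] by linarith
    then have "\<bar>real_of_int (x $ i)\<bar> \<le> 2 * r / h" using h_pos by (simp add: field_simps)
    also have "\<dots> \<le> b" unfolding b_def by simp
    finally show "\<bar>x $ i\<bar> \<le> b" by linarith
  qed
  then show ?thesis using fin by (rule finite_subset)
qed

text \<open>The sublevel set is finite, so the times and constants of its points can be made
  uniform. The target depends on the class only, as Harris' argument requires.\<close>

lemma minorization:
  obtains N \<epsilon> where "N > 0" "\<epsilon> > 0"
    "\<And>z g. z \<in> states \<Longrightarrow> weight h z \<le> r \<Longrightarrow> (\<And>y. y \<in> sig_class (signature z) \<Longrightarrow> g y \<ge> 0) \<Longrightarrow>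
      ((zz_op U \<circ> zz_op U) ^^ N) g z \<ge> \<epsilon> * g (0, signature z)"
proof -
  let ?S = "{z \<in> (states :: 'd::{finite,linorder} state set). weight h z \<le> r}"
  have fin: "finite ?S" by (rule finite_sublevel)
  have "\<forall>z\<in>?S. \<exists>T0. \<forall>T\<ge>T0. even T \<longrightarrow>
    (\<forall>i. ((fst z $ i, snd z $ i), (0 $ i, signature z $ i)) \<in> coord_step R ^^ T)"
  proof
    fix z assume "z \<in> ?S"
    then have "snd z \<in> signs" by (auto simp: states_def)
    from reach_center[OF this, of "fst z"] show "\<exists>T0. \<forall>T\<ge>T0. even T \<longrightarrow>
      (\<forall>i. ((fst z $ i, snd z $ i), (0 $ i, signature z $ i)) \<in> coord_step R ^^ T)"
      unfolding prod.collapse .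
  qed
  from bchoice[OF this] obtain T0 where "\<forall>z\<in>?S. \<forall>T\<ge>T0 z. even T \<longrightarrow>
    (\<forall>i. ((fst z $ i, snd z $ i), (0 $ i, signature z $ i)) \<in> coord_step R ^^ T)" ..
  note T0 = this[rule_format]
  \<comment> \<open>The sum dominates every threshold, and \<open>Suc\<close> keeps N positive if
    the sublevel set is empty; the 1 inserted into the minimum below covers the same case.\<close>
  define N where "N = Suc (\<Sum>z\<in>?S. T0 z)"
  have N: "T0 z \<le> 2 * N" if "z \<in> ?S" for z
    using member_le_sum[OF that, of T0] fin unfolding N_def by simp
  have "\<forall>z\<in>?S. \<exists>c>0. \<forall>g. (\<forall>z\<in>states. g z \<ge> 0) \<longrightarrow> (zz_op U ^^ (2 * N)) g z \<ge> c * g (0, signature z)"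
  proof
    fix z assume z: "z \<in> ?S"
    have "\<exists>c>0. \<forall>g. (\<forall>z\<in>states. g z \<ge> 0) \<longrightarrow> (zz_op U ^^ (2 * N)) g (fst z, snd z) \<ge> c * g (0, signature z)"
      using z by (intro zz_op_power_ge T0 N) (auto simp: states_def)
    then show "\<exists>c>0. \<forall>g. (\<forall>z\<in>states. g z \<ge> 0) \<longrightarrow> (zz_op U ^^ (2 * N)) g z \<ge> c * g (0, signature z)"
      by simp
  qed
  from bchoice[OF this] obtain c where c: "\<And>z. z \<in> ?S \<Longrightarrow> c z > 0"
    "\<And>z g. z \<in> ?S \<Longrightarrow> (\<forall>z\<in>states. g z \<ge> 0) \<Longrightarrow> (zz_op U ^^ (2 * N)) g z \<ge> c z * g (0, signature z)"
    by blast
  define \<epsilon> where "\<epsilon> = Min (insert 1 (c ` ?S))"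
  have \<epsilon>: "\<epsilon> > 0" "\<And>z. z \<in> ?S \<Longrightarrow> \<epsilon> \<le> c z"
    unfolding \<epsilon>_def using fin c(1) by (auto simp: Min_gr_iff intro!: Min_le)
  show thesis
  proof (rule that[OF _ \<epsilon>(1)])
    show "N > 0" by (simp add: N_def)
    fix z :: "'d::{finite,linorder} state" and g :: "'d::{finite,linorder} state \<Rightarrow> real"
    assume z: "z \<in> states" "weight h z \<le> r"
      and g: "\<And>y. y \<in> sig_class (signature z) \<Longrightarrow> g y \<ge> 0"
    \<comment> \<open>The path bounds ask for nonnegativity on all states. Even powers do not leave
      the class, so g may be replaced by 0 elsewhere.\<close>
    define g' where "g' y = (if y \<in> sig_class (signature z) then g y else 0)" for y
    have zc: "z \<in> sig_class (signature z)" using z by (simp add: sig_class_def)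
    have "signature (0, signature z) = signature z" "signature z \<in> signs"
      using z by (cases z; simp add: vec_eq_iff)+
    then have "g' (0, signature z) = g (0, signature z)" "g' (0, signature z) \<ge> 0"
      using g by (auto simp: g'_def sig_class_def)
    then have "\<epsilon> * g (0, signature z) \<le> c z * g' (0, signature z)"
      using \<epsilon>(2)[of z] z by (simp add: mult_right_mono)
    also have "\<dots> \<le> ((zz_op U \<circ> zz_op U) ^^ N) g' z"
      unfolding funpow_2_times[symmetric] using z g by (intro c(2)) (auto simp: g'_def)
    also have "\<dots> \<le> ((zz_op U \<circ> zz_op U) ^^ N) g z"
      by (intro markov_on_mono[OF markov_on_power[OF markov_zz_op_two] zc]) (simp add: g'_def)
    finally show "((zz_op U \<circ> zz_op U) ^^ N) g z \<ge> \<epsilon> * g (0, signature z)" .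
  qed
qed

end

section \<open>Ergodicity\<close>

lemma has_sum_abs_diff_le:
  fixes f g :: "'a \<Rightarrow> real"
  assumes "(f has_sum a) A" "(g has_sum b) A" "\<And>x. x \<in> A \<Longrightarrow> \<bar>f x\<bar> \<le> g x"
  shows "\<bar>a\<bar> \<le> b"
proof -
  have "a \<le> b" using assms(3) by (intro has_sum_mono[OF assms(1,2)]) fastforce
  moreover have "- a \<le> b"
    using assms(3) by (intro has_sum_mono[OF has_sum_uminusI[OF assms(1)] assms(2)]) fastforce
  ultimately show ?thesis by linarith
qed

context zig_zag
begin

lemma gibbs_summable_of_bounded:
  assumes "\<And>z. z \<in> states \<Longrightarrow> \<bar>f z\<bar> \<le> lyapunov h z" "\<And>x. v x \<in> signs"
  shows "(\<lambda>x. gibbs U x * f (x, v x)) summable_on UNIV"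
proof (rule summable_on_iff_abs_summable_on_real[THEN iffD2], rule Infinite_Sum.abs_summable_on_comparison_test)
  show "(\<lambda>x. norm (gibbs U x * lyapunov h (x, v x))) summable_on UNIV"
    by (intro summable_on_iff_abs_summable_on_real[THEN iffD1] gibbs_lyapunov_summable)
  fix x
  have "\<bar>f (x, v x)\<bar> \<le> \<bar>lyapunov h (x, v x)\<bar>" using assms(1)[of "(x, v x)"] assms(2)[of x] by simp
  then show "norm (gibbs U x * f (x, v x)) \<le> norm (gibbs U x * lyapunov h (x, v x))"
    by (simp add: abs_mult mult_left_mono)
qed

text \<open>The contraction is run on each class, but drift and minorization constants do not depend
  on the class, so one C and one \<rho> serve all. The limit enters by averaging the oscillation
  bound over its second point with Gibbs weights, an average that even powers preserve.\<close>

lemma geometric_ergodicity: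
  "\<exists>C>0. \<exists>\<rho>. 0 < \<rho> \<and> \<rho> < 1 \<and> (\<forall>x. \<forall>v\<in>signs. \<forall>n f. (\<forall>z\<in>states. \<bar>f z\<bar> \<le> lyapunov h z) \<longrightarrow>
     \<bar>((zz_op U \<circ> zz_op U) ^^ n) f (x, v) - (\<Sum>\<^sub>\<infinity>y. gibbs U y * f (y, signature (y, signature (x, v))))\<bar>
       \<le> C * \<rho> ^ n * lyapunov h (x, v))"
proof -
  define K where "K = zz_op U \<circ> zz_op U"
  define V where "V = (weight h :: 'd::{finite,linorder} state \<Rightarrow> real)"
  define C1 where "C1 = CARD('d) * C0 / (1 - \<gamma>)"
  define r where "r = 4 * (C1 + 1) / (1 - \<gamma>)"
  have C0: "real CARD('d) * C0 \<ge> 0" by (simp add: C0_def)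
  have C1: "C1 \<ge> 0" unfolding C1_def using gamma C0 by (intro divide_nonneg_nonneg) auto
  have drift: "(K ^^ m) V z \<le> \<gamma> ^ (2 * m) * V z + C1" if "z \<in> states" for z m
    unfolding K_def funpow_2_times[symmetric] C1_def V_def
    using that zz_drift by (intro drift_power[OF markov_zz_op_states gamma C0]) auto
  have V0: "V z \<ge> 0" for z unfolding V_def by (rule weight_nonneg)
  obtain N \<epsilon> where N: "N > 0" and \<epsilon>: "\<epsilon> > 0" and
    minor: "\<And>z g. z \<in> states \<Longrightarrow> V z \<le> r \<Longrightarrow> (\<And>y. y \<in> sig_class (signature z) \<Longrightarrow> g y \<ge> 0) \<Longrightarrow>
      (K ^^ N) g z \<ge> \<epsilon> * g (0, signature z)"
    unfolding K_def V_def using minorization[of r] by metis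
  obtain \<alpha> \<beta> where \<beta>: "0 < \<beta>" and \<alpha>: "0 < \<alpha>" "\<alpha> < 1"
    and far: "\<And>D. D \<ge> r \<Longrightarrow> 2 + \<gamma> * \<beta> * D + 2 * \<beta> * C1 \<le> \<alpha> * (2 + \<beta> * D)"
    and near: "\<And>D. D \<ge> 0 \<Longrightarrow> 2 - 2 * \<epsilon> + \<gamma> * \<beta> * D + 2 * \<beta> * C1 \<le> \<alpha> * (2 + \<beta> * D)"
    using harris_constants[OF gamma C1 \<epsilon> r_def] by metis
  \<comment> \<open>Chosen so that V a + V b + 2 * C1, a bound on the oscillation of
    \<open>f'\<close> below, is at most L * (2 + \<beta> * (V a + V b)).\<close>
  define L where "L = max (1 / \<beta>) C1"
  have L: "L > 0" "1 \<le> L * \<beta>" "C1 \<le> L"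
  proof -
    have "1 / \<beta> > 0" using \<beta> by simp
    then show "L > 0" unfolding L_def by linarith
    have "1 / \<beta> * \<beta> \<le> L * \<beta>" unfolding L_def using \<beta> by (intro mult_right_mono) auto
    then show "1 \<le> L * \<beta>" using \<beta> by simp
  qed (simp add: L_def)
  \<comment> \<open>A factor \<alpha> is gained once per N double steps, so the rate per double step
    is the N-th root.\<close>
  define \<rho> where "\<rho> = root N \<alpha>"
  have \<rho>: "0 < \<rho>" "\<rho> < 1" "\<rho> ^ N = \<alpha>"
    using N \<alpha> by (auto simp: \<rho>_def real_root_pow_pos2)
  \<comment> \<open>\<open>lyapunov\<close> ignores the velocity, so the 0, which is not a sign
    vector, is a placeholder.\<close>
  define B where "B = (\<Sum>\<^sub>\<infinity>y. gibbs U y * lyapunov h (y, 0))"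
  have B_sum: "((\<lambda>y. gibbs U y * lyapunov h (y, w y)) has_sum B) UNIV" for w
    using gibbs_lyapunov_summable[of "\<lambda>_. 0"] unfolding B_def by (simp add: lyapunov_def)
  have B: "B \<ge> 0" unfolding B_def
    by (intro infsum_nonneg mult_nonneg_nonneg gibbs_nonneg) (auto simp: lyapunov_def intro!: sum_nonneg)
  \<comment> \<open>1 / \<alpha> pays for the incomplete block of double steps. The bracket collects
    the constant 2, the bound 4 * \<open>lyapunov\<close> for V and the bound 4 * B for the Gibbs
    mean of V, all absorbed by \<open>lyapunov\<close> being at least 1.\<close>
  define C where "C = L / \<alpha> * (2 + 4 * \<beta> + 4 * \<beta> * B)"
  have "C > 0" unfolding C_def using L(1) \<alpha> \<beta> B by (intro mult_pos_pos divide_pos_pos add_pos_nonneg) auto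
  moreover have "\<bar>(K ^^ n) f (x, v) - (\<Sum>\<^sub>\<infinity>y. gibbs U y * f (y, signature (y, signature (x, v))))\<bar>
       \<le> C * \<rho> ^ n * lyapunov h (x, v)"
    if v: "v \<in> signs" and f: "\<forall>z\<in>states. \<bar>f z\<bar> \<le> lyapunov h z" for x v n f
  proof -
    define s where "s = signature (x, v)"
    have s: "s \<in> signs" using v by (simp add: s_def)
    define m where "m = n div N"
    define k where "k = n mod N"
    have n: "n = N * m + k" "k \<le> N" using N by (auto simp: m_def k_def less_imp_le)
    define z where "z = (x, v)"
    have z: "z \<in> sig_class s" using v by (simp add: z_def s_def sig_class_def)
    have y: "(y, signature (y, s)) \<in> sig_class s" for y
      using s by (simp add: sig_class_def vec_eq_iff)
    have K: "markov_on (sig_class s) (sig_class s) (K ^^ j)" for j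
      unfolding K_def by (rule markov_on_power[OF markov_zz_op_two])
    have st: "a \<in> states" if "a \<in> sig_class s" for a using that sig_class_subset by blast
    \<comment> \<open>The k leftover double steps are applied to f first: the drift bounds the
      result by V + C1 uniformly in k, so the contraction always starts from the same L.\<close>
    define f' where "f' = (K ^^ k) f"
    have f': "\<bar>f' a\<bar> \<le> V a + C1" if a: "a \<in> sig_class s" for a
    proof -
      have "\<bar>f' a\<bar> \<le> (K ^^ k) V a"
        unfolding f'_def using f st lyapunov_le_weight unfolding V_def
        by (intro markov_on_abs_le[OF K a]) (blast intro: order_trans)
      also have "\<dots> \<le> \<gamma> ^ (2 * k) * V a + C1" by (rule drift[OF st[OF a]])
      also have "\<gamma> ^ (2 * k) * V a \<le> 1 * V a"
        using gamma V0 by (intro mult_right_mono power_le_one) auto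
      finally show ?thesis by simp
    qed
    have "\<bar>f' a - f' b\<bar> \<le> L * (2 + \<beta> * (V a + V b))" if "a \<in> sig_class s" "b \<in> sig_class s" for a b
    proof -
      have "1 * (V a + V b) \<le> L * \<beta> * (V a + V b)" using L V0 by (intro mult_right_mono) auto
      then show ?thesis using f'[OF that(1)] f'[OF that(2)] L(3) by (simp add: algebra_simps)
    qed
    moreover have "(K ^^ N) V a \<le> \<gamma> * V a + C1" if "a \<in> sig_class s" for a
    proof -
      have "\<gamma> ^ (2 * N) \<le> \<gamma> ^ 1" using gamma N by (intro power_decreasing) auto
      then have "\<gamma> ^ (2 * N) * V a \<le> \<gamma> * V a" using V0 by (intro mult_right_mono) auto
      then show ?thesis using drift[OF st[OF that], of N] by simp
    qed
    moreover have "(0, s) \<in> sig_class s" using s by (simp add: sig_class_def vec_eq_iff)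
    moreover have "(K ^^ N) g a \<ge> \<epsilon> * g (0, s)"
      if "a \<in> sig_class s" "V a \<le> r" "\<And>y. y \<in> sig_class s \<Longrightarrow> g y \<ge> 0" for a g
      using minor[OF st[OF that(1)] that(2), of g] that by (simp add: sig_class_def)
    ultimately have "\<bar>((K ^^ N) ^^ m) f' a - ((K ^^ N) ^^ m) f' b\<bar> \<le> \<alpha> ^ m * L * (2 + \<beta> * (V a + V b))"
      if "a \<in> sig_class s" "b \<in> sig_class s" for a b
      using that L(1) \<epsilon> by (intro harris_power[OF K V0 _ _ _ _ \<beta> \<alpha>(1) far near]) auto
    moreover have "((K ^^ N) ^^ m) f' = (K ^^ n) f"
      unfolding f'_def n(1) by (simp add: funpow_mult funpow_add)
    ultimately have osc: "\<bar>(K ^^ n) f a - (K ^^ n) f b\<bar> \<le> \<alpha> ^ m * L * (2 + \<beta> * (V a + V b))"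
      if "a \<in> sig_class s" "b \<in> sig_class s" for a b
      using that by metis
    define G where "G = (K ^^ n) f z"
    define I where "I = (\<Sum>\<^sub>\<infinity>y. gibbs U y * f (y, signature (y, s)))"
    define A where "A = \<alpha> ^ m * L"
    have A: "A > 0" using \<alpha> L(1) by (simp add: A_def)
    have "((\<lambda>y. gibbs U y * f (y, signature (y, s))) has_sum I) UNIV"
      unfolding I_def using f s by (intro has_sum_infsum gibbs_summable_of_bounded) auto
    from zz_op_even_power_invariant[OF s this, of n]
    have I: "((\<lambda>y. gibbs U y * (K ^^ n) f (y, signature (y, s))) has_sum I) UNIV"
      unfolding K_def .
    \<comment> \<open>The Gibbs weights sum to 1, so G - I is an average of differences controlled
      by \<open>osc\<close>.\<close>
    have "((\<lambda>y. gibbs U y * G + - (gibbs U y * (K ^^ n) f (y, signature (y, s)))) has_sum (1 * G + - I)) UNIV"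
      by (intro has_sum_add has_sum_uminusI I has_sum_cmult_left gibbs_has_sum)
    moreover have "((\<lambda>y. gibbs U y * (A * (2 + \<beta> * V z)) + A * \<beta> * 4 * (gibbs U y * lyapunov h (y, signature (y, s))))
        has_sum (1 * (A * (2 + \<beta> * V z)) + A * \<beta> * 4 * B)) UNIV"
      by (intro has_sum_add has_sum_cmult_left has_sum_cmult_right gibbs_has_sum B_sum)
    moreover have "\<bar>gibbs U y * G + - (gibbs U y * (K ^^ n) f (y, signature (y, s)))\<bar>
        \<le> gibbs U y * (A * (2 + \<beta> * V z)) + A * \<beta> * 4 * (gibbs U y * lyapunov h (y, signature (y, s)))" for y
    proof -
      let ?y = "(y, signature (y, s))"
      have "\<bar>gibbs U y * G + - (gibbs U y * (K ^^ n) f ?y)\<bar> = gibbs U y * \<bar>G - (K ^^ n) f ?y\<bar>"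
        using gibbs_nonneg[of U y] by (simp add: abs_mult flip: right_diff_distrib)
      also have "\<dots> \<le> gibbs U y * (A * (2 + \<beta> * (V z + 4 * lyapunov h ?y)))"
      proof (rule mult_left_mono[OF _ gibbs_nonneg])
        have "\<bar>G - (K ^^ n) f ?y\<bar> \<le> A * (2 + \<beta> * (V z + V ?y))"
          unfolding G_def A_def by (intro osc z y)
        also have "\<dots> \<le> A * (2 + \<beta> * (V z + 4 * lyapunov h ?y))"
          using A \<beta> weight_le_lyapunov[of h ?y] by (intro mult_left_mono add_left_mono) (auto simp: V_def)
        finally show "\<bar>G - (K ^^ n) f ?y\<bar> \<le> A * (2 + \<beta> * (V z + 4 * lyapunov h ?y))" .
      qed
      also have "\<dots> = gibbs U y * (A * (2 + \<beta> * V z)) + A * \<beta> * 4 * (gibbs U y * lyapunov h ?y)"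
        by (simp add: algebra_simps)
      finally show ?thesis .
    qed
    ultimately have "\<bar>1 * G + - I\<bar> \<le> 1 * (A * (2 + \<beta> * V z)) + A * \<beta> * 4 * B"
      by (rule has_sum_abs_diff_le)
    then have "\<bar>G - I\<bar> \<le> A * (2 + \<beta> * V z + 4 * \<beta> * B)" by (simp add: algebra_simps)
    also have "\<dots> \<le> A * ((2 + 4 * \<beta> + 4 * \<beta> * B) * lyapunov h z)"
    proof (intro mult_left_mono)
      have "lyapunov h z \<ge> 1" unfolding z_def using h_pos by (intro lyapunov_ge_1) auto
      then have "(2 + 4 * \<beta> * B) * 1 \<le> (2 + 4 * \<beta> * B) * lyapunov h z"
        using \<beta> B by (intro mult_left_mono) auto
      moreover have "\<beta> * V z \<le> \<beta> * (4 * lyapunov h z)"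
        using \<beta> weight_le_lyapunov[of h z] by (intro mult_left_mono) (auto simp: V_def)
      ultimately show "2 + \<beta> * V z + 4 * \<beta> * B \<le> (2 + 4 * \<beta> + 4 * \<beta> * B) * lyapunov h z"
        by (simp add: algebra_simps)
    qed (use A in simp)
    also have "\<dots> \<le> \<rho> ^ n / \<alpha> * L * ((2 + 4 * \<beta> + 4 * \<beta> * B) * lyapunov h z)"
    proof (intro mult_right_mono)
      have "\<rho> ^ n = \<alpha> ^ m * \<rho> ^ k" unfolding n(1) power_add power_mult \<rho>(3) ..
      moreover have "\<rho> ^ N \<le> \<rho> ^ k" using n(2) \<rho> by (intro power_decreasing) auto
      ultimately have "\<alpha> ^ m * \<alpha> \<le> \<rho> ^ n" unfolding \<rho>(3) using \<alpha> by simp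
      then have "\<alpha> ^ m \<le> \<rho> ^ n / \<alpha>" using \<alpha> by (simp add: field_simps)
      then show "A \<le> \<rho> ^ n / \<alpha> * L" unfolding A_def using L by (intro mult_right_mono) auto
      show "0 \<le> (2 + 4 * \<beta> + 4 * \<beta> * B) * lyapunov h z"
        using \<beta> B lyapunov_ge_1[of h x v] h_pos by (intro mult_nonneg_nonneg) (auto simp: z_def)
    qed
    also have "\<dots> = C * \<rho> ^ n * lyapunov h z" by (simp add: C_def)
    finally show ?thesis unfolding G_def I_def z_def s_def .
  qed
  ultimately show ?thesis using \<rho>(1,2) unfolding K_def by blast
qed

end

section \<open>Translation to measures\<close>

text \<open>Summability of reals is absolute, so \<open>has_sum\<close> already yields Bochner
  integrability; \<open>infsetsum\<close> links the two notions.\<close>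

lemma has_sum_point_measure:
  fixes f k :: "'a \<Rightarrow> real"
  assumes "\<And>z. z \<in> A \<Longrightarrow> k z \<ge> 0" "((\<lambda>z. k z * f z) has_sum I) A"
  shows "integrable (point_measure A (\<lambda>z. ennreal (k z))) f"
    and "(\<integral>z. f z \<partial>point_measure A (\<lambda>z. ennreal (k z))) = I"
proof -
  have "(\<lambda>z. norm (k z * f z)) summable_on A"
    using assms(2) by (intro summable_on_iff_abs_summable_on_real[THEN iffD1] has_sum_imp_summable)
  then have *: "Infinite_Set_Sum.abs_summable_on (\<lambda>z. k z * f z) A"
    using abs_summable_equivalent by blast
  have AE: "AE z in count_space A. 0 \<le> k z" using assms(1) by (simp add: AE_count_space)
  show "integrable (point_measure A (\<lambda>z. ennreal (k z))) f"
    unfolding point_measure_def using * AE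
    by (subst integrable_density) (auto simp: abs_summable_on_def)
  have "(\<integral>z. f z \<partial>point_measure A (\<lambda>z. ennreal (k z))) = infsetsum (\<lambda>z. k z * f z) A"
    unfolding point_measure_def using AE by (subst integral_density) (auto simp: infsetsum_def)
  also have "\<dots> = I" using infsetsum_infsum[OF *] infsumI[OF assms(2)] by simp
  finally show "(\<integral>z. f z \<partial>point_measure A (\<lambda>z. ennreal (k z))) = I" .
qed

lemma meas_op_dirac:
  fixes f :: "'d::finite state \<Rightarrow> real"
  assumes P: "markov_on S states P" and z: "z \<in> S" "S \<subseteq> states"
  shows "integrable (meas_op (dirac z) P) f" and "(\<integral>y. f y \<partial>meas_op (dirac z) P) = P f z"
proof -
  obtain p where p: "finite (set_pmf p)" "set_pmf p \<subseteq> states"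
    "\<And>f. P f z = measure_pmf.expectation p f"
    using markov_onE[OF P z(1)] by metis
  have "(\<integral>y. P (indicator {u}) y \<partial>dirac z) = pmf p u" for u
  proof -
    have "(\<integral>y. P (indicator {u}) y \<partial>dirac z) = P (indicator {u}) z"
      unfolding dirac_def using z by (intro integral_return) auto
    also have "\<dots> = pmf p u" unfolding p(3) by (simp add: pmf.rep_eq)
    finally show ?thesis .
  qed
  then have eq: "meas_op (dirac z) P = point_measure states (\<lambda>u. ennreal (pmf p u))"
    unfolding meas_op_def by simp
  have "P f z = (\<Sum>u\<in>set_pmf p. pmf p u * f u)"
    unfolding p(3) using p(1) by (subst integral_measure_pmf_real[of "set_pmf p"]) (auto simp: mult.commute)
  then have sum: "((\<lambda>u. pmf p u * f u) has_sum P f z) states"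
    using p by (intro has_sum_finite_neutralI[of "set_pmf p"]) (auto simp: set_pmf_iff)
  show "integrable (meas_op (dirac z) P) f" "(\<integral>y. f y \<partial>meas_op (dirac z) P) = P f z"
    unfolding eq by (rule has_sum_point_measure[OF pmf_nonneg sum])+
qed

text \<open>The density vanishes off the graph of the class velocity, so the integral over states
  reduces to a sum over positions.\<close>

lemma sig_measure_has_sum:
  fixes f :: "'d::finite state \<Rightarrow> real"
  assumes s: "s \<in> signs" and f: "((\<lambda>x. gibbs U x * f (x, signature (x, s))) has_sum I) UNIV"
  shows "integrable (sig_measure U s) f" and "(\<integral>z. f z \<partial>sig_measure U s) = I"
proof -
  define k where "k = (\<lambda>(x, v). gibbs U x * of_bool (v = velocity x s))"
  have eq: "sig_measure U s = point_measure states (\<lambda>z. ennreal (k z))"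
    unfolding sig_measure_def k_def by (simp add: case_prod_unfold)
  define j where "j x = (x, signature (x, s))" for x
  have "inj j" by (simp add: inj_def j_def)
  have "((\<lambda>z. k z * f z) \<circ> j) = (\<lambda>x. gibbs U x * f (x, signature (x, s)))"
    by (auto simp: k_def j_def sig_velocity[OF s])
  then have "((\<lambda>z. k z * f z) has_sum I) (range j)"
    unfolding has_sum_reindex[OF \<open>inj j\<close>] using f by simp
  also have "?this \<longleftrightarrow> ((\<lambda>z. k z * f z) has_sum I) states"
  proof (rule has_sum_cong_neutral)
    fix z assume "z \<in> states - range j"
    then show "k z * f z = 0" by (cases z) (auto simp: k_def j_def sig_velocity[OF s])
  qed (use s in \<open>auto simp: j_def\<close>)
  finally have sum: "((\<lambda>z. k z * f z) has_sum I) states" .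
  have k: "k z \<ge> 0" for z by (auto simp: k_def gibbs_nonneg split: prod.split)
  show "integrable (sig_measure U s) f" "(\<integral>z. f z \<partial>sig_measure U s) = I"
    unfolding eq by (rule has_sum_point_measure[OF k sum])+
qed

theorem theorem11:
  fixes U :: "int ^ 'd::{finite,linorder} \<Rightarrow> real"
    and R h :: real and xmin :: "int ^ 'd::{finite,linorder}"
  assumes "(\<lambda>x. exp (- U x)) summable_on UNIV"
    and "strict_local_min U xmin"
    and "R > 0" and "h > 0"
    and "\<And>i x v. v \<in> signs \<Longrightarrow>
           max (U (x + v $ i *s axis i 1) - U x) 0 \<ge> h * of_bool (real_of_int (v $ i * x $ i) > R)"
  shows "\<exists>C>0. \<exists>\<rho>. 0 < \<rho> \<and> \<rho> < 1 \<and>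
           (\<forall>x. \<forall>v\<in>signs. \<forall>n\<ge>1.
              weighted_dist (lyapunov h)
                (meas_op (dirac (x, v)) (zz_op U ^^ (2 * n))) (sig_measure U (signature (x, v)))
              \<le> ereal (C * \<rho> ^ n * lyapunov h (x, v)))"
proof -
  interpret zig_zag U R h using assms by unfold_locales auto
  obtain C \<rho> where C: "C > 0" "0 < \<rho>" "\<rho> < 1"
    and erg: "\<And>x v n f. v \<in> signs \<Longrightarrow> (\<forall>z\<in>states. \<bar>f z\<bar> \<le> lyapunov h z) \<Longrightarrow>
     \<bar>((zz_op U \<circ> zz_op U) ^^ n) f (x, v) - (\<Sum>\<^sub>\<infinity>y. gibbs U y * f (y, signature (y, signature (x, v))))\<bar>
       \<le> C * \<rho> ^ n * lyapunov h (x, v)"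
    using geometric_ergodicity by blast
  have "weighted_dist (lyapunov h)
      (meas_op (dirac (x, v)) (zz_op U ^^ (2 * n))) (sig_measure U (signature (x, v)))
      \<le> ereal (C * \<rho> ^ n * lyapunov h (x, v))" if v: "v \<in> signs" for x v n
  proof -
    define s where "s = signature (x, v)"
    have s: "s \<in> signs" using v by (simp add: s_def)
    have z: "(x, v) \<in> states" using v by simp
    note P = meas_op_dirac[OF markov_on_power[OF markov_zz_op_states] z subset_refl]
    have sum: "((\<lambda>y. gibbs U y * f (y, signature (y, s))) has_sum
        (\<Sum>\<^sub>\<infinity>y. gibbs U y * f (y, signature (y, s)))) UNIV"
      if "\<forall>z\<in>states. \<bar>f z\<bar> \<le> lyapunov h z" for f
      using that s by (intro has_sum_infsum gibbs_summable_of_bounded) auto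
    \<comment> \<open>\<open>lyapunov\<close> is itself an admissible test function. Its
      integrability under the limit follows and, with \<open>P\<close>, rules out the value
      \<infinity> in \<open>weighted_dist\<close>.\<close>
    have "\<forall>z\<in>states. \<bar>lyapunov h z\<bar> \<le> lyapunov h z"
      by (auto simp: lyapunov_def intro!: sum_nonneg)
    note W = sig_measure_has_sum(1)[OF s sum[OF this]]
    show ?thesis
      unfolding weighted_dist_def s_def[symmetric]
    proof (subst if_P)
      show "(SUP f\<in>{f. \<forall>z\<in>states. \<bar>f z\<bar> \<le> lyapunov h z}.
          ereal ((\<integral>z. f z \<partial>meas_op (dirac (x, v)) (zz_op U ^^ (2 * n))) - (\<integral>z. f z \<partial>sig_measure U s)))
          \<le> ereal (C * \<rho> ^ n * lyapunov h (x, v))"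
      proof (rule SUP_least, clarsimp simp del: funpow.simps)
        fix f :: "'d::{finite,linorder} state \<Rightarrow> real"
        assume f: "\<forall>z\<in>states. \<bar>f z\<bar> \<le> lyapunov h z"
        from erg[OF v f, of n x]
        show "(\<integral>z. f z \<partial>meas_op (dirac (x, v)) (zz_op U ^^ (2 * n))) - (\<integral>z. f z \<partial>sig_measure U s)
          \<le> C * \<rho> ^ n * lyapunov h (x, v)"
          unfolding P(2) sig_measure_has_sum(2)[OF s sum[OF f]]
          unfolding funpow_2_times s_def by linarith
      qed
    qed (use P W in auto)
  qed
  then show ?thesis using C by blast
qed

end
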